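(* There exists a Stone space (a compact Hausdorff zero-dimensional space) $K$ such that for every ordinal $1\leq \alpha<\omega_1$ we have $S_\alpha(K)\setminus \bigcup_{\beta<\alpha}S_\beta(K)\neq \emptyset$.
   Context: For a compact Hausdorff space $K$, $P(K)$ denotes the set of (Radon) Borel probability measures on $K$ with the weak$^*$ topology (as functionals on $C(K)$), so $\mu_n\to\mu$ iff $\int f\,d\mu_n\to\int f\,d\mu$ for every $f\in C(K)$. For $A\subseteq K$, let $S_0(A)=\mathrm{conv}\{\delta_x : x\in A\}$, the set of finitely supported probability measures with support in $A$ ($\delta_x$ the Dirac measure at $x$). For an ordinal $0<\alpha\leq\omega_1$, recursively let $S_\alpha(A)$ be the set of all weak$^*$ limits in $P(K)$ of convergent sequences $(\mu_n)_{n\in\omega}$ such that for every $n$ there is $\beta<\alpha$ with $\mu_n\in S_\beta(A)$. *)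

theory Defs
  imports "HOL-Probability.Probability" "HOL-Library.Countable_Set_Type"
begin

subsection \<open>Stone spaces\<close>

definition stone_space :: "'a topology \<Rightarrow> bool" where
  "stone_space K \<longleftrightarrow> compact_space K \<and> Hausdorff_space K \<and>
     neighbourhood_base_of (\<lambda>U. openin K U \<and> closedin K U) K"

subsection \<open>Radon probability measures and weak* convergence of sequences\<close>

definition borel_of :: "'a topology \<Rightarrow> 'a measure" where
  "borel_of K = sigma (topspace K) {U. openin K U}"

text \<open>The set \<open>P(K)\<close>. For finite measures, inner regularity with respect to compact sets is
  the whole Radon condition.\<close>
definition radon_probs :: "'a topology \<Rightarrow> 'a measure set" where
  "radon_probs K = {\<mu>. sets \<mu> = sets (borel_of K) \<and> prob_space \<mu> \<and>
     (\<forall>B\<in>sets \<mu>. emeasure \<mu> B = (SUP C\<in>{C. compactin K C \<and> C \<subseteq> B}. emeasure \<mu> C))}"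

definition weak_star_lim :: "'a topology \<Rightarrow> (nat \<Rightarrow> 'a measure) \<Rightarrow> 'a measure \<Rightarrow> bool" where
  "weak_star_lim K \<nu> \<mu> \<longleftrightarrow>
     (\<forall>f. continuous_map K euclideanreal f \<longrightarrow>
        (\<lambda>n. integral\<^sup>L (\<nu> n) f) \<longlonglongrightarrow> integral\<^sup>L \<mu> f)"

text \<open>The convex hull of the Dirac measures at points of \<open>A\<close>. Isabelle measures carry no vector
  space structure, so the convex combination is written out on Borel sets.\<close>
definition conv_diracs :: "'a topology \<Rightarrow> 'a set \<Rightarrow> 'a measure set" where
  "conv_diracs K A = {\<mu> \<in> radon_probs K. \<exists>F c. finite F \<and> F \<subseteq> A \<and>
     (\<forall>x\<in>F. 0 \<le> c x) \<and> (\<Sum>x\<in>F. c x) = 1 \<and>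
     (\<forall>B\<in>sets \<mu>. measure \<mu> B = (\<Sum>x\<in>F. c x * measure (return (borel_of K) x) B))}"

subsection \<open>The sequential hierarchy\<close>

text \<open>Ordinals are the elements of a well-ordered type with least element \<open>bot\<close>, which plays the
  role of the ordinal 0. \<open>S K A \<alpha>\<close> is the level \<open>S\<^sub>\<alpha>(A)\<close> in \<open>P(K)\<close>.\<close>
function S :: "'a topology \<Rightarrow> 'a set \<Rightarrow> 'o::{wellorder,order_bot} \<Rightarrow> 'a measure set" where
  "S K A \<alpha> = (if \<alpha> = bot then conv_diracs K A
     else {\<mu> \<in> radon_probs K. \<exists>\<nu>. (\<forall>n. \<exists>\<beta>\<in>{..<\<alpha>}. \<nu> n \<in> S K A \<beta>) \<and> weak_star_lim K \<nu> \<mu>})"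
  by pat_completeness auto
termination
  by (relation "inv_image {(x, y). x < y} (\<lambda>(K, A, \<alpha>). \<alpha>)") (auto intro: wf)

declare S.simps [simp del]

subsection \<open>The ordinals below the first uncountable ordinal\<close>

text \<open>\<open>cardSuc natLeq\<close> is the successor cardinal of \<open>\<aleph>\<^sub>0\<close>, i.e. a well-order of
  type \<open>\<omega>\<^sub>1\<close>; the elements of its field are the countable ordinals.\<close>
typedef omega1 = "Field (cardSuc natLeq)"
proof -
  have "infinite (Field (cardSuc natLeq))"
    using cardSuc_finite[OF natLeq_Card_order] by (simp add: Field_natLeq)
  then show ?thesis
    by (metis ex_in_conv finite.emptyI)
qed

setup_lifting type_definition_omega1

lemma Well_order_cardSuc_natLeq: "Well_order (cardSuc natLeq)"
  using cardSuc_Card_order[OF natLeq_Card_order] by (rule card_order_on_well_order_on)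

instantiation omega1 :: wellorder
begin

lift_definition less_eq_omega1 :: "omega1 \<Rightarrow> omega1 \<Rightarrow> bool"
  is "\<lambda>a b. (a, b) \<in> cardSuc natLeq" .

definition less_omega1 :: "omega1 \<Rightarrow> omega1 \<Rightarrow> bool" where
  "less_omega1 a b \<longleftrightarrow> a \<le> b \<and> \<not> b \<le> a"

instance
proof
  note W = Well_order_cardSuc_natLeq[unfolded well_order_on_def linear_order_on_def
      partial_order_on_def preorder_on_def]
  fix x y z :: omega1
  show "x < y \<longleftrightarrow> x \<le> y \<and> \<not> y \<le> x"
    by (rule less_omega1_def)
  show le_refl: "x \<le> x" for x :: omega1
    using W by transfer (auto simp: refl_on_def)
  show "x \<le> y \<Longrightarrow> y \<le> z \<Longrightarrow> x \<le> z"
    using W by transfer (auto dest: transD)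
  show anti: "x \<le> y \<Longrightarrow> y \<le> x \<Longrightarrow> x = y" for x y :: omega1
    using W by transfer (auto dest: antisymD)
  show "x \<le> y \<or> y \<le> x"
    using W le_refl[of x] by transfer (auto simp: total_on_def)
  fix P :: "omega1 \<Rightarrow> bool" and a :: omega1
  assume step: "\<And>x. (\<And>y. y < x \<Longrightarrow> P y) \<Longrightarrow> P x"
  have "wf (inv_image (cardSuc natLeq - Id) Rep_omega1)"
    using W by (intro wf_inv_image) auto
  then show "P a"
  proof (induction a rule: wf_induct_rule)
    case (less x)
    show ?case
    proof (rule step)
      fix y assume "y < x"
      then have "y \<le> x" "y \<noteq> x" unfolding less_omega1_def by auto
      then show "P y"
        by (intro less.IH) (simp add: less_eq_omega1.rep_eq Rep_omega1_inject)
    qed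
  qed
qed

end

instantiation omega1 :: order_bot
begin

definition bot_omega1 :: omega1 where
  "bot_omega1 = (LEAST \<alpha>. True)"

instance
  by standard (simp add: bot_omega1_def Least_le)

end

lemma countable_lessThan_omega1:
  includes cardinal_syntax
  shows "countable {..<\<alpha>::omega1}"
proof -
  have "card_of (underS (cardSuc natLeq) (Rep_omega1 \<alpha>)) <o cardSuc natLeq"
    by (intro card_of_underS cardSuc_Card_order natLeq_Card_order Rep_omega1)
  then have "countable (underS (cardSuc natLeq) (Rep_omega1 \<alpha>))"
    by (simp add: countable_card_le_natLeq cardSuc_ordLeq_ordLess natLeq_Card_order card_of_Card_order)
  moreover have "Rep_omega1 ` {..<\<alpha>} \<subseteq> underS (cardSuc natLeq) (Rep_omega1 \<alpha>)"
    by (auto simp: underS_def less_omega1_def less_eq_omega1.rep_eq Rep_omega1_inject)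
  ultimately have "countable (Rep_omega1 ` {..<\<alpha>})"
    by (rule countable_subset[rotated])
  then show ?thesis
    by (rule countable_image_inj_on) (simp add: inj_on_def Rep_omega1_inject)
qed

lemma uncountable_omega1:
  includes cardinal_syntax
  shows "uncountable (UNIV :: omega1 set)"
proof
  assume "countable (UNIV :: omega1 set)"
  then have "countable (range Rep_omega1)" by simp
  then have "countable (Field (cardSuc natLeq))"
    by (simp add: type_definition.Rep_range[OF type_definition_omega1])
  then have "card_of (Field (cardSuc natLeq)) \<le>o natLeq"
    by (simp add: countable_card_le_natLeq)
  moreover have "natLeq <o card_of (Field (cardSuc natLeq))"
    using cardSuc_greater[OF natLeq_Card_order]
      card_of_Field_ordIso[OF cardSuc_Card_order[OF natLeq_Card_order]]
    by (meson ordIso_symmetric ordLess_ordIso_trans)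
  ultimately show False
    using not_ordLess_ordLeq by blast
qed

end

theory Submission
  imports Defs "HOL-Library.Sublist"
begin

text \<open>
  The space \<open>K\<close> is the Stone space of an algebra \<open>\<A>\<close> of sets, so that measures on \<open>K\<close> are finitely
  additive probabilities on \<open>\<A>\<close> and weak* convergence of a sequence is convergence on each member
  of \<open>\<A>\<close>. The algebra is built so that iterated limits of Lebesgue measure exist in \<open>K\<close>, but cannot
  be reached faster than the iteration prescribes.

  Take a forest of well-founded trees whose nodes are labelled by countable ordinals: the tree of
  \<open>\<alpha>\<close> has a root labelled \<open>\<alpha>\<close>, and the children of a node labelled \<open>\<gamma>\<close> are labelled by ordinals
  below \<open>\<gamma>\<close> that are eventually at least \<open>\<beta>\<close>, for every \<open>\<beta> < \<gamma>\<close>. A member \<open>A\<close> of the algebra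
  assigns to each node \<open>t\<close> a Borel set \<open>sec A t\<close> of \<open>[0, 1)\<close>: a finite union of dyadic intervals if
  \<open>t\<close> is a leaf, and otherwise the limit in measure of the sets assigned to the children of \<open>t\<close>.
  Let \<open>\<lambda>\<^sub>t\<close> be the measure on \<open>K\<close> that takes \<open>A\<close> to the Lebesgue measure of \<open>sec A t\<close>.

  Upper bound: \<open>\<lambda>\<^sub>t\<close> is a limit of finitely supported measures if \<open>t\<close> is a leaf, because dyadic
  points are equidistributed, and it is the limit of the measures of the children otherwise. So every
  \<open>\<lambda>\<^sub>t\<close> occurs in the hierarchy (\<open>node_measure_in_hierarchy\<close>).

  Lower bound (\<open>small_support\<close>): each measure in \<open>S\<^sub>\<beta>\<close> is concentrated, inside a given tree, on some
  \<open>A \<in> \<A>\<close> for which \<open>sec A t\<close> is small at every node with label above \<open>\<beta>\<close>. For finitely supported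
  measures this holds since \<open>[0, 1)\<close> splits into small dyadic intervals. In the inductive step the
  sets \<open>A\<^sub>k\<close> belonging to a convergent sequence are joined to a single set. The union satisfies the limit
  condition at a node of high label because it is a uniform limit of finite unions there; at a node
  of label at most \<open>\<beta>\<close>, subtracting larger and larger finite families of low subtrees from the
  \<open>A\<^sub>k\<close> leaves a finite union. The mass of the subtracted part is absorbed by one such finite family.
  Consequently the measure of the root labelled \<open>\<alpha>\<close> is in no \<open>S\<^sub>\<beta>\<close> with \<open>\<beta> < \<alpha>\<close>.

  If \<open>S\<^sub>\<alpha>\<close> added nothing to the earlier levels, the hierarchy would be constant from \<open>\<alpha>\<close> on
  (\<open>S_stabilises\<close>), and the measure of the root labelled \<open>\<alpha>\<close> could not occur at all. So strictness
  at \<open>\<alpha>\<close> follows from the lower bound together with the mere fact that this measure has some level.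
\<close>

section \<open>The Stone space of an algebra of sets\<close>

text \<open>Points are the \<open>{0, 1}\<close>-valued homomorphisms. They are stored as predicates on codes of the members
  of the algebra, so that the type of the points can be chosen independently of the type of the
  underlying set; a point is false off the codes, which makes the clopen sets \<open>cl A\<close> a base.\<close>
locale stone_algebra = algebra \<Omega> M for \<Omega> :: "'z set" and M +
  fixes code :: "'z set \<Rightarrow> 'w"
  assumes inj_code: "inj_on code M"
begin

definition pts :: "('w \<Rightarrow> bool) set" where
  "pts = {\<phi>. (\<forall>w. w \<notin> code ` M \<longrightarrow> \<not> \<phi> w) \<and> \<phi> (code \<Omega>) \<and>
     (\<forall>A\<in>M. \<phi> (code (\<Omega> - A)) \<longleftrightarrow> \<not> \<phi> (code A)) \<and>
     (\<forall>A\<in>M. \<forall>B\<in>M. \<phi> (code (A \<union> B)) \<longleftrightarrow> \<phi> (code A) \<or> \<phi> (code B))}"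

definition K :: "('w \<Rightarrow> bool) topology" where
  "K = subtopology (product_topology (\<lambda>_. discrete_topology UNIV) UNIV) pts"

text \<open>The clopen set that corresponds to \<open>A\<close> under Stone duality.\<close>
definition cl :: "'z set \<Rightarrow> ('w \<Rightarrow> bool) set" where
  "cl A = {\<phi> \<in> pts. \<phi> (code A)}"

definition ev :: "'z \<Rightarrow> 'w \<Rightarrow> bool" where
  "ev z = (\<lambda>w. \<exists>A\<in>M. w = code A \<and> z \<in> A)"

lemma topspace_K [simp]: "topspace K = pts"
  by (simp add: K_def)

lemma ev_code [simp]: "A \<in> M \<Longrightarrow> ev z (code A) \<longleftrightarrow> z \<in> A"
  using inj_code by (auto simp: ev_def inj_on_def)

lemma ev_in_pts: "z \<in> \<Omega> \<Longrightarrow> ev z \<in> pts"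
proof -
  assume z: "z \<in> \<Omega>"
  have "\<not> ev z w" if "w \<notin> code ` M" for w
    using that by (auto simp: ev_def)
  moreover have "ev z (code (\<Omega> - A)) \<longleftrightarrow> \<not> ev z (code A)" if "A \<in> M" for A
    using that z ev_code[OF that] ev_code[OF compl_sets[OF that]] by simp
  moreover have "ev z (code (A \<union> B)) \<longleftrightarrow> ev z (code A) \<or> ev z (code B)" if "A \<in> M" "B \<in> M" for A B
    using that by (simp add: Un)
  ultimately show ?thesis
    using z unfolding pts_def by simp
qed

lemma ev_in_cl [simp]: "z \<in> \<Omega> \<Longrightarrow> A \<in> M \<Longrightarrow> ev z \<in> cl A \<longleftrightarrow> z \<in> A"
  by (simp add: cl_def ev_in_pts)

lemma cl_subset_pts: "cl A \<subseteq> pts"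
  by (auto simp: cl_def)

lemma cl_Un: "A \<in> M \<Longrightarrow> B \<in> M \<Longrightarrow> cl (A \<union> B) = cl A \<union> cl B"
  by (auto simp: cl_def pts_def)

lemma cl_compl: "A \<in> M \<Longrightarrow> cl (\<Omega> - A) = pts - cl A"
  by (auto simp: cl_def pts_def)

lemma cl_space [simp]: "cl \<Omega> = pts"
  by (auto simp: cl_def pts_def)

lemma cl_empty [simp]: "cl {} = {}"
  using cl_compl[OF top] by simp

lemma cl_Int: "A \<in> M \<Longrightarrow> B \<in> M \<Longrightarrow> cl (A \<inter> B) = cl A \<inter> cl B"
proof -
  assume AB: "A \<in> M" "B \<in> M"
  have "A \<inter> B = \<Omega> - ((\<Omega> - A) \<union> (\<Omega> - B))"
    using AB sets_into_space by blast
  then have "cl (A \<inter> B) = pts - cl ((\<Omega> - A) \<union> (\<Omega> - B))"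
    using AB by (simp only: cl_compl compl_sets Un)
  also have "\<dots> = cl A \<inter> cl B"
    using AB cl_subset_pts[of A] by (auto simp: cl_Un cl_compl compl_sets)
  finally show ?thesis .
qed

lemma cl_Diff: "A \<in> M \<Longrightarrow> B \<in> M \<Longrightarrow> cl (A - B) = cl A - cl B"
proof -
  assume AB: "A \<in> M" "B \<in> M"
  have "A - B = A \<inter> (\<Omega> - B)"
    using AB sets_into_space by blast
  then show ?thesis
    using AB cl_subset_pts[of A] by (auto simp: cl_Int cl_compl compl_sets)
qed

lemma cl_mono: "A \<in> M \<Longrightarrow> B \<in> M \<Longrightarrow> A \<subseteq> B \<Longrightarrow> cl A \<subseteq> cl B"
  by (metis Un_upper1 cl_Un subset_Un_eq)

text \<open>The evaluations \<open>ev z\<close> are points, so no member of the algebra is lost in the Stone space.\<close>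
lemma cl_subset_iff: "A \<in> M \<Longrightarrow> B \<in> M \<Longrightarrow> cl A \<subseteq> cl B \<longleftrightarrow> A \<subseteq> B"
proof
  assume AB: "A \<in> M" "B \<in> M" and sub: "cl A \<subseteq> cl B"
  show "A \<subseteq> B"
  proof
    fix z assume "z \<in> A"
    moreover from this have "z \<in> \<Omega>" using AB sets_into_space by blast
    ultimately show "z \<in> B"
      using AB sub ev_in_cl by blast
  qed
qed (rule cl_mono)

lemma cl_finite_UN:
  assumes "finite I" "\<And>i. i \<in> I \<Longrightarrow> F i \<in> M"
  shows "(\<Union>i\<in>I. F i) \<in> M \<and> cl (\<Union>i\<in>I. F i) = (\<Union>i\<in>I. cl (F i))"
  using assms by (induction I) (auto simp: cl_Un)

lemma clopen_coordinate:
  fixes P :: "('w \<Rightarrow> bool) topology"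
  assumes P_def: "P = product_topology (\<lambda>_. discrete_topology UNIV) UNIV"
  shows "openin P {\<phi>. \<phi> w}" "closedin P {\<phi>. \<phi> w}"
    "closedin P {\<phi>. \<not> \<phi> w}"
proof -
  have cont: "continuous_map P (discrete_topology UNIV) (\<lambda>\<phi>. \<phi> w)"
    unfolding P_def by (intro continuous_map_product_projection) simp
  have P_top: "topspace P = UNIV"
    by (simp add: P_def)
  show "openin P {\<phi>. \<phi> w}"
    using openin_continuous_map_preimage[OF cont, of "{True}"] by (simp add: P_top)
  show "closedin P {\<phi>. \<phi> w}" "closedin P {\<phi>. \<not> \<phi> w}"
    using closedin_continuous_map_preimage[OF cont, of "{True}"]
      closedin_continuous_map_preimage[OF cont, of "{False}"] by (simp_all add: P_top)
qed

lemma closedin_pts: "closedin (product_topology (\<lambda>_. discrete_topology UNIV) UNIV) pts"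
proof -
  define P :: "('w \<Rightarrow> bool) topology" where
    P_def: "P = product_topology (\<lambda>_. discrete_topology UNIV) UNIV"
  note coord = clopen_coordinate[OF P_def]
  define \<C> where "\<C> = (\<lambda>w. {\<phi>. \<not> \<phi> w}) ` (- code ` M) \<union> {{\<phi>. \<phi> (code \<Omega>)}} \<union>
     (\<lambda>A. {\<phi>. \<phi> (code (\<Omega> - A)) \<longleftrightarrow> \<not> \<phi> (code A)}) ` M \<union>
     (\<lambda>(A, B). {\<phi>. \<phi> (code (A \<union> B)) \<longleftrightarrow> \<phi> (code A) \<or> \<phi> (code B)}) ` (M \<times> M)"
  have iff: "closedin P {\<phi>. X \<phi> \<longleftrightarrow> Y \<phi>}"
    if "closedin P {\<phi>. X \<phi>}" "closedin P {\<phi>. \<not> X \<phi>}" "closedin P {\<phi>. Y \<phi>}" "closedin P {\<phi>. \<not> Y \<phi>}"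
    for X Y
  proof -
    have "{\<phi>. X \<phi> \<longleftrightarrow> Y \<phi>} = {\<phi>. X \<phi>} \<inter> {\<phi>. Y \<phi>} \<union> {\<phi>. \<not> X \<phi>} \<inter> {\<phi>. \<not> Y \<phi>}"
      by auto
    then show ?thesis
      using that by (simp only: closedin_Un closedin_Int)
  qed
  have "closedin P C" if C: "C \<in> \<C>" for C
  proof -
    have 1: "closedin P {\<phi>. \<phi> (code (\<Omega> - A)) \<longleftrightarrow> \<not> \<phi> (code A)}" for A
      by (intro iff) (simp_all add: coord)
    have 2: "closedin P {\<phi>. \<phi> (code (A \<union> B)) \<longleftrightarrow> \<phi> (code A) \<or> \<phi> (code B)}" for A B
    proof (rule iff)
      show "closedin P {\<phi>. \<phi> (code A) \<or> \<phi> (code B)}"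
        using closedin_Un[OF coord(2) coord(2)] by (simp add: Collect_disj_eq)
      show "closedin P {\<phi>. \<not> (\<phi> (code A) \<or> \<phi> (code B))}"
        using closedin_Int[OF coord(3) coord(3)] by (simp add: Collect_conj_eq)
    qed (rule coord)+
    show ?thesis
      using C 1 2 coord unfolding \<C>_def by auto
  qed
  then have "closedin P (\<Inter>\<C>)"
    by (intro closedin_Inter) (auto simp: \<C>_def)
  also have "\<Inter>\<C> = pts"
    unfolding \<C>_def pts_def by auto
  finally show ?thesis
    unfolding P_def .
qed

lemma compact_K: "compact_space K"
  unfolding K_def
  by (intro compact_space_subtopology closedin_compact_space closedin_pts)
     (simp add: compact_space_product_topology compact_space_discrete_topology)

lemma Hausdorff_K: "Hausdorff_space K"
  unfolding K_def
  by (intro Hausdorff_space_subtopology) (simp add: Hausdorff_space_product_topology)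

lemma openin_cl: "openin K (cl A)" and closedin_cl: "closedin K (cl A)"
proof -
  have eq: "cl A = {\<phi>. \<phi> (code A)} \<inter> pts"
    by (auto simp: cl_def)
  show "openin K (cl A)" "closedin K (cl A)"
    unfolding K_def openin_subtopology closedin_subtopology eq
    using clopen_coordinate by blast+
qed

lemma compactin_cl: "compactin K (cl A)"
  by (intro closedin_compact_space compact_K closedin_cl)

text \<open>A basic open set of the product constrains finitely many coordinates, and each constraint on a
  coordinate cuts out some \<open>cl A\<close>.\<close>
lemma cl_base:
  assumes "openin K U" "\<phi> \<in> U"
  shows "\<exists>A\<in>M. \<phi> \<in> cl A \<and> cl A \<subseteq> U"
proof -
  define P :: "('w \<Rightarrow> bool) topology" where
    P_def: "P = product_topology (\<lambda>_. discrete_topology UNIV) UNIV"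
  obtain V where V: "openin P V" "U = V \<inter> pts"
    using assms(1) unfolding K_def openin_subtopology P_def by blast
  then obtain W where W: "finite {w. W w \<noteq> UNIV}" "\<phi> \<in> (\<Pi>\<^sub>E w\<in>UNIV. W w)" "(\<Pi>\<^sub>E w\<in>UNIV. W w) \<subseteq> V"
    using assms(2) unfolding P_def openin_product_topology_alt by auto
  have \<phi>: "\<phi> \<in> pts"
    using V assms by simp
  define F where "F = {w. W w \<noteq> UNIV}"
  \<comment> \<open>\<open>cl (N w)\<close> is the clopen neighbourhood of \<open>\<phi>\<close> on which the coordinate \<open>w\<close> agrees with \<open>\<phi>\<close>; if \<open>w\<close> is not a
    code, all points are false at \<open>w\<close>.\<close>
  define N where "N w = (if w \<in> code ` M then
      (if \<phi> w then the_inv_into M code w else \<Omega> - the_inv_into M code w) else \<Omega>)" for w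
  have N: "N w \<in> M \<and> \<phi> \<in> cl (N w) \<and> (\<forall>\<psi>\<in>cl (N w). \<psi> w = \<phi> w)" for w
  proof (cases "w \<in> code ` M")
    case True
    then obtain A where A: "A \<in> M" "w = code A" by blast
    have "the_inv_into M code w = A"
      using A the_inv_into_f_f[OF inj_code] by simp
    then show ?thesis
      using A \<phi> by (auto simp: N_def cl_compl) (auto simp: cl_def)
  next
    case False
    then show ?thesis
      using \<phi> by (auto simp: N_def) (auto simp: pts_def)
  qed
  define agree where "agree w = {\<psi>. \<psi> w = \<phi> w}" for w
  have N': "N w \<in> M" "\<phi> \<in> cl (N w)" "cl (N w) \<subseteq> agree w" for w
    using N[of w] by (simp_all add: agree_def subset_iff)
  have *: "\<exists>A\<in>M. \<phi> \<in> cl A \<and> cl A \<subseteq> (\<Inter>w\<in>G. agree w)" if "finite G" for G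
    using that
  proof induction
    case empty
    then show ?case using \<phi> top by (intro bexI[of _ \<Omega>]) auto
  next
    case (insert w G)
    from insert.IH obtain A where A: "A \<in> M" "\<phi> \<in> cl A" "cl A \<subseteq> (\<Inter>w\<in>G. agree w)"
      by (elim bexE conjE)
    have "cl (A \<inter> N w) = cl A \<inter> cl (N w)" "A \<inter> N w \<in> M"
      using A(1) N'(1) by (rule cl_Int, rule Int)
    then show ?case
      using A N'[of w] by (intro bexI[of _ "A \<inter> N w"]) (simp_all add: le_infI1 le_infI2)
  qed
  from *[OF W(1)] obtain A where A: "A \<in> M" "\<phi> \<in> cl A" "cl A \<subseteq> (\<Inter>w\<in>{w. W w \<noteq> UNIV}. agree w)"
    by (elim bexE conjE)
  have "cl A \<subseteq> U"
  proof
    fix \<psi> assume \<psi>: "\<psi> \<in> cl A"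
    have "\<psi> w \<in> W w" for w
    proof (cases "W w = UNIV")
      case False
      then have "\<psi> \<in> agree w" using A(3) \<psi> by (simp add: subset_iff)
      then have "\<psi> w = \<phi> w" by (simp add: agree_def)
      moreover have "\<phi> w \<in> W w" using W(2) by (simp add: PiE_iff)
      ultimately show ?thesis by (rule ssubst)
    qed simp
    then show "\<psi> \<in> U"
      using W(3) V(2) subsetD[OF cl_subset_pts \<psi>] by (simp add: PiE_UNIV_domain subset_iff)
  qed
  then show ?thesis using A by blast
qed

lemma stone_space_K: "stone_space K"
  unfolding stone_space_def neighbourhood_base_of
proof (intro conjI compact_K Hausdorff_K allI impI)
  fix W \<phi> assume "openin K W \<and> \<phi> \<in> W"
  then obtain A where "A \<in> M" "\<phi> \<in> cl A" "cl A \<subseteq> W"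
    using cl_base by blast
  then show "\<exists>U V. openin K U \<and> (openin K V \<and> closedin K V) \<and> \<phi> \<in> U \<and> U \<subseteq> V \<and> V \<subseteq> W"
    using openin_cl closedin_cl by blast
qed

lemma space_borel_of_K [simp]: "space (borel_of K) = pts"
  by (simp add: borel_of_def space_measure_of_conv)

lemma openin_sets_borel: "openin K U \<Longrightarrow> U \<in> sets (borel_of K)"
proof -
  have "{U. openin K U} \<subseteq> Pow (topspace K)"
    using openin_subset by blast
  then show "openin K U \<Longrightarrow> U \<in> sets (borel_of K)"
    by (auto simp: borel_of_def)
qed

lemma cl_sets_borel: "cl A \<in> sets (borel_of K)"
  by (intro openin_sets_borel openin_cl)

end

section \<open>Radon measures from finitely additive ones\<close>

context stone_algebra begin

definition fin_add_prob :: "('z set \<Rightarrow> real) \<Rightarrow> bool" where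
  "fin_add_prob m \<longleftrightarrow> (\<forall>A\<in>M. 0 \<le> m A) \<and> m \<Omega> = 1 \<and>
     (\<forall>A\<in>M. \<forall>B\<in>M. A \<inter> B = {} \<longrightarrow> m (A \<union> B) = m A + m B)"

lemma fin_add_prob_mono:
  assumes "fin_add_prob m" "A \<in> M" "B \<in> M" "A \<subseteq> B"
  shows "m (B - A) = m B - m A" "m A \<le> m B"
proof -
  have "m (A \<union> (B - A)) = m A + m (B - A)"
    using assms unfolding fin_add_prob_def by blast
  moreover have "A \<union> (B - A) = B" using assms by blast
  ultimately show "m (B - A) = m B - m A" by simp
  moreover have "0 \<le> m (B - A)"
    using assms by (auto simp: fin_add_prob_def)
  ultimately show "m A \<le> m B" by simp
qed

lemma fin_add_prob_empty: "fin_add_prob m \<Longrightarrow> m {} = 0"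
  using fin_add_prob_mono(1)[of m "{}" "{}"] by simp

lemma fin_add_prob_Un_le:
  assumes "fin_add_prob m" "A \<in> M" "B \<in> M"
  shows "m (A \<union> B) \<le> m A + m B"
proof -
  have "m (A \<union> (B - A)) = m A + m (B - A)"
    using assms unfolding fin_add_prob_def by blast
  moreover have "m (B - A) \<le> m B"
    using assms by (intro fin_add_prob_mono) auto
  ultimately show ?thesis by simp
qed

lemma fin_add_prob_UN_le:
  assumes m: "fin_add_prob m" and "finite I" "\<And>i. i \<in> I \<Longrightarrow> F i \<in> M"
  shows "m (\<Union>i\<in>I. F i) \<le> (\<Sum>i\<in>I. m (F i))"
  using assms(2,3)
proof (induction I)
  case empty
  then show ?case using fin_add_prob_empty[OF m] by simp
next
  case (insert i I)
  have "m (F i \<union> (\<Union>i\<in>I. F i)) \<le> m (F i) + m (\<Union>i\<in>I. F i)"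
    using insert by (intro fin_add_prob_Un_le m) auto
  then show ?case
    using insert by force
qed

text \<open>The clopen sets only generate the Baire sets, so the extension theorem for premeasures would not
  reach all Borel sets. Instead the outer measure is defined from the values \<open>\<tau> U\<close> on open sets; compactness
  makes \<open>\<tau>\<close> countably subadditive, open sets are Caratheodory measurable, and outer regularity, which
  holds by construction, becomes the Radon property by complementation.\<close>
lemma radon_extension:
  assumes m: "fin_add_prob m"
  shows "\<exists>\<mu>\<in>radon_probs K. \<forall>A\<in>M. measure \<mu> (cl A) = m A"
proof -
  define \<tau> where "\<tau> U = (SUP A\<in>{A\<in>M. cl A \<subseteq> U}. ennreal (m A))" for U
  define f where "f E = (INF U\<in>{U. openin K U \<and> E \<subseteq> U}. \<tau> U)" for E
  have \<tau>_mono: "\<tau> U \<le> \<tau> V" if "U \<subseteq> V" for U V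
    unfolding \<tau>_def using that by (intro SUP_subset_mono) auto
  have \<tau>_upper: "ennreal (m A) \<le> \<tau> U" if "A \<in> M" "cl A \<subseteq> U" for A U
    unfolding \<tau>_def using that by (intro SUP_upper) auto
  have \<tau>_cl: "\<tau> (cl A) = ennreal (m A)" if A: "A \<in> M" for A
  proof (rule antisym)
    show "\<tau> (cl A) \<le> ennreal (m A)"
      unfolding \<tau>_def using A fin_add_prob_mono(2)[OF m]
      by (intro SUP_least) (auto simp: cl_subset_iff intro!: ennreal_leI)
  qed (simp add: \<tau>_upper A)
  have f_open: "f U = \<tau> U" if "openin K U" for U
    unfolding f_def using that by (intro antisym INF_lower INF_greatest \<tau>_mono) auto
  have f_le: "f E \<le> \<tau> U" if "openin K U" "E \<subseteq> U" for E U
    unfolding f_def using that by (intro INF_lower) auto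
  have f_mono: "f E \<le> f E'" if "E \<subseteq> E'" for E E'
    unfolding f_def using that by (intro INF_superset_mono) auto
  have f_empty: "f {} = 0"
    using f_open[of "{}"] \<tau>_cl[of "{}"] fin_add_prob_empty[OF m] by simp
  have f_pts: "f pts = 1"
    using f_open[OF openin_cl[of \<Omega>]] \<tau>_cl[OF top] m by (simp add: fin_add_prob_def)
  have \<tau>_UN: "\<tau> (\<Union>n. U n) \<le> (\<Sum>n. \<tau> (U n))" if U: "\<And>n::nat. openin K (U n)" for U
    unfolding \<tau>_def[of "\<Union>n. U n"]
  proof (intro SUP_least, clarify)
    fix A assume A: "A \<in> M" "cl A \<subseteq> (\<Union>n. U n)"
    define \<F> where "\<F> = {B \<in> M. \<exists>n. cl B \<subseteq> U n}"
    have "\<exists>\<G>. finite \<G> \<and> \<G> \<subseteq> cl ` \<F> \<and> cl A \<subseteq> \<Union>\<G>"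
    proof (rule compactinD[OF compactin_cl])
      show "cl A \<subseteq> \<Union> (cl ` \<F>)"
      proof
        fix \<phi> assume "\<phi> \<in> cl A"
        then obtain n where "\<phi> \<in> U n" using A by blast
        then obtain B where "B \<in> M" "\<phi> \<in> cl B" "cl B \<subseteq> U n" using cl_base U by blast
        then show "\<phi> \<in> \<Union> (cl ` \<F>)" by (auto simp: \<F>_def)
      qed
    qed (auto simp: openin_cl)
    then obtain F where F: "finite F" "F \<subseteq> \<F>" "cl A \<subseteq> (\<Union>B\<in>F. cl B)"
      by (metis finite_subset_image)
    have "\<forall>B\<in>F. \<exists>n. cl B \<subseteq> U n" using F(2) by (auto simp: \<F>_def)
    then obtain i where i: "\<And>B. B \<in> F \<Longrightarrow> cl B \<subseteq> U (i B)" by metis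
    \<comment> \<open>Group the finite subcover by the open set containing each member, so that each open set is
      charged only once.\<close>
    define G where "G n = (\<Union>B\<in>{B\<in>F. i B = n}. B)" for n
    have FM: "B \<in> M" if "B \<in> F" for B using that F(2) by (auto simp: \<F>_def)
    have G: "G n \<in> M" "cl (G n) \<subseteq> U n" for n
      using cl_finite_UN[of "{B\<in>F. i B = n}" "\<lambda>B. B"] F(1) FM i by (auto simp: G_def)
    have "(\<Union>B\<in>F. B) \<in> M" "cl A \<subseteq> cl (\<Union>B\<in>F. B)"
      using cl_finite_UN[of F "\<lambda>B. B"] F FM by auto
    then have "A \<subseteq> (\<Union>B\<in>F. B)"
      using A(1) cl_subset_iff by blast
    then have "A \<subseteq> (\<Union>n\<in>i ` F. G n)"
      unfolding G_def by blast
    then have "m A \<le> m (\<Union>n\<in>i ` F. G n)"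
      using A F G by (intro fin_add_prob_mono[OF m] finite_UN) auto
    also have "\<dots> \<le> (\<Sum>n\<in>i ` F. m (G n))"
      using F G by (intro fin_add_prob_UN_le m) auto
    finally have "ennreal (m A) \<le> ennreal (\<Sum>n\<in>i ` F. m (G n))"
      by (rule ennreal_leI)
    also have "\<dots> = (\<Sum>n\<in>i ` F. ennreal (m (G n)))"
      using m G by (intro sum_ennreal[symmetric]) (auto simp: fin_add_prob_def)
    also have "\<dots> \<le> (\<Sum>n\<in>i ` F. \<tau> (U n))"
      by (intro sum_mono \<tau>_upper G)
    also have "\<dots> \<le> (\<Sum>n. \<tau> (U n))"
      using F by (intro sum_le_suminf) auto
    finally show "ennreal (m A) \<le> (\<Sum>n. \<tau> (U n))" .
  qed
  have f_le_1: "f E \<le> 1" if "E \<subseteq> pts" for E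
    using f_mono[OF that] f_pts by simp
  have csub: "f (\<Union>n. E n) \<le> (\<Sum>n. f (E n))" if E: "\<And>n::nat. E n \<subseteq> pts" for E
  proof (rule ennreal_le_epsilon)
    fix e :: real assume e: "0 < e"
    have "\<exists>U. openin K U \<and> E n \<subseteq> U \<and> \<tau> U \<le> f (E n) + ennreal (e * (1/2) ^ Suc n)" for n
    proof -
      have "f (E n) < f (E n) + ennreal (e * (1/2) ^ Suc n)"
        using f_le_1[OF E[of n]] e
        by (cases "f (E n)") (auto simp: ennreal_plus[symmetric] ennreal_less_iff top_unique simp del: ennreal_plus)
      then have "\<exists>U\<in>{U. openin K U \<and> E n \<subseteq> U}. \<tau> U < f (E n) + ennreal (e * (1/2) ^ Suc n)"
        unfolding f_def[of "E n"] INF_less_iff .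
      then show ?thesis by (auto intro: less_imp_le)
    qed
    then obtain U where U: "\<And>n. openin K (U n)" "\<And>n. E n \<subseteq> U n"
      "\<And>n. \<tau> (U n) \<le> f (E n) + ennreal (e * (1/2) ^ Suc n)"
      by metis
    have "f (\<Union>n. E n) \<le> \<tau> (\<Union>n. U n)"
      using U by (intro f_le openin_Union) auto
    also have "\<dots> \<le> (\<Sum>n. \<tau> (U n))"
      by (intro \<tau>_UN U)
    also have "\<dots> \<le> (\<Sum>n. f (E n) + ennreal (e * (1/2) ^ Suc n))"
      by (intro suminf_le U) auto
    also have "\<dots> = (\<Sum>n. f (E n)) + (\<Sum>n. ennreal (e * (1/2) ^ Suc n))"
      by (intro suminf_add[symmetric]) auto
    also have "(\<Sum>n. ennreal (e * (1/2) ^ Suc n)) = ennreal e"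
      using e sums_mult[OF power_half_series, of e] by (intro suminf_ennreal_eq) auto
    finally show "f (\<Union>n. E n) \<le> (\<Sum>n. f (E n)) + ennreal e" .
  qed
  interpret P: sigma_algebra pts "Pow pts"
    by (rule sigma_algebra_Pow)
  have outer: "outer_measure_space (Pow pts) f"
    unfolding outer_measure_space_def
    unfolding positive_def increasing_def countably_subadditive_def
    using f_empty f_mono by (auto intro!: csub simp: UN_subset_iff)
  define L where "L = lambda_system pts (Pow pts) f"
  have ms: "measure_space pts L f"
    unfolding L_def by (rule P.caratheodory_lemma[OF outer])
  have sub2: "f (A \<union> B) \<le> f A + f B" if "A \<subseteq> pts" "B \<subseteq> pts" "A \<inter> B = {}" for A B
    using P.countably_subadditive_subadditive[of f] outer that
    by (auto simp: outer_measure_space_def subadditive_def)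
  have open_L: "U \<in> L" if U: "openin K U" for U
    unfolding L_def P.lambda_system_eq
  proof (intro CollectI conjI ballI antisym)
    show "U \<in> Pow pts" using openin_subset[OF U] by simp
  next
    fix X assume X: "X \<in> Pow pts"
    show "f X \<le> f (X \<inter> U) + f (X - U)"
      using sub2[of "X \<inter> U" "X - U"] X by (simp add: Int_Diff_Un Un_Diff_Int) blast
    have "f (X \<inter> U) + f (X - U) \<le> \<tau> V" if V: "openin K V" "X \<subseteq> V" for V
    proof -
      have "ennreal (m A) + f (X - U) \<le> \<tau> V" if A: "A \<in> M" "cl A \<subseteq> V \<inter> U" for A
      proof -
        have "f (X - U) \<le> \<tau> (V - cl A)"
          using A V by (intro f_le openin_diff closedin_cl) auto
        then have "ennreal (m A) + f (X - U) \<le> ennreal (m A) + \<tau> (V - cl A)"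
          by (rule add_left_mono)
        also have "\<dots> = (SUP B\<in>{B\<in>M. cl B \<subseteq> V - cl A}. ennreal (m A) + ennreal (m B))"
          unfolding \<tau>_def by (intro ennreal_SUP_add_right) (auto intro: exI[of _ "{}"])
        also have "\<dots> \<le> \<tau> V"
        proof (intro SUP_least, clarify)
          fix B assume B: "B \<in> M" "cl B \<subseteq> V - cl A"
          have "cl (A \<inter> B) = {}"
            using B A by (auto simp: cl_Int)
          then have "A \<inter> B = {}"
            using cl_subset_iff[of "A \<inter> B" "{}"] A B by auto
          then have "ennreal (m A) + ennreal (m B) = ennreal (m (A \<union> B))"
            using m A B by (simp add: fin_add_prob_def)
          also have "\<dots> \<le> \<tau> V"
            using A B by (intro \<tau>_upper) (auto simp: cl_Un)
          finally show "ennreal (m A) + ennreal (m B) \<le> \<tau> V" .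
        qed
        finally show ?thesis .
      qed
      then have "(SUP A\<in>{A\<in>M. cl A \<subseteq> V \<inter> U}. ennreal (m A) + f (X - U)) \<le> \<tau> V"
        by (intro SUP_least) auto
      also have "(SUP A\<in>{A\<in>M. cl A \<subseteq> V \<inter> U}. ennreal (m A) + f (X - U)) = \<tau> (V \<inter> U) + f (X - U)"
        unfolding \<tau>_def by (intro ennreal_SUP_add_left) (auto intro: exI[of _ "{}"])
      finally have "\<tau> (V \<inter> U) + f (X - U) \<le> \<tau> V" .
      moreover have "f (X \<inter> U) \<le> \<tau> (V \<inter> U)"
        using U V by (intro f_le openin_Int) auto
      ultimately show ?thesis
        by (meson add_right_mono order_trans)
    qed
    then show "f (X \<inter> U) + f (X - U) \<le> f X"
      unfolding f_def[of X] by (intro INF_greatest) auto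
  qed
  have sub_Pow: "{U. openin K U} \<subseteq> Pow pts"
    using openin_subset[of K] by auto
  define \<mu> where "\<mu> = measure_of pts {U. openin K U} f"
  have sets_\<mu>: "sets \<mu> = sigma_sets pts {U. openin K U}"
    unfolding \<mu>_def using sub_Pow by (rule sets_measure_of)
  have sets_eq: "sets \<mu> = sets (borel_of K)"
    unfolding sets_\<mu> borel_of_def using sub_Pow by simp
  have space_\<mu>: "space \<mu> = pts"
    unfolding \<mu>_def using sub_Pow by (rule space_measure_of)
  have sets_L: "sets \<mu> \<subseteq> L"
    unfolding sets_\<mu> using ms open_L
    by (intro sigma_algebra.sigma_sets_subset) (auto simp: measure_space_def)
  have em: "emeasure \<mu> B = f B" if "B \<in> sets \<mu>" for B
  proof (rule emeasure_measure_of[OF \<mu>_def sub_Pow _ _ that])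
    show "positive (sets \<mu>) f"
      using f_empty by (simp add: positive_def)
    show "countably_additive (sets \<mu>) f"
      using ms sets_L unfolding measure_space_def countably_additive_def by blast
  qed
  have open_sets: "U \<in> sets \<mu>" if "openin K U" for U
    unfolding sets_eq by (rule openin_sets_borel[OF that])
  have prob: "prob_space \<mu>"
    using em[of pts] f_pts openin_topspace[of K] sets.top[of \<mu>] by (intro prob_spaceI) (simp add: space_\<mu>)
  interpret \<mu>: prob_space \<mu> by (rule prob)
  have compl: "f (pts - B) + f B = 1" if B: "B \<in> sets \<mu>" for B
  proof -
    have "pts - B \<in> sets \<mu>"
      using sets.compl_sets[OF B] by (simp add: space_\<mu>)
    moreover have "(pts - B) \<union> B = pts"
      using sets.sets_into_space[OF B] by (auto simp: space_\<mu>)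
    ultimately have "emeasure \<mu> (pts - B) + emeasure \<mu> B = emeasure \<mu> pts"
      using plus_emeasure[of "pts - B" \<mu> B] B by auto
    then show ?thesis
      using B \<open>pts - B \<in> sets \<mu>\<close> em f_pts sets.top[of \<mu>] by (simp add: space_\<mu>)
  qed
  have radon: "emeasure \<mu> B = (SUP C\<in>{C. compactin K C \<and> C \<subseteq> B}. emeasure \<mu> C)" (is "_ = ?s")
    if B: "B \<in> sets \<mu>" for B
  proof (rule antisym)
    show "?s \<le> emeasure \<mu> B"
      using B by (intro SUP_least emeasure_mono) auto
    have "1 - ?s \<le> \<tau> U" if U: "openin K U" "pts - B \<subseteq> U" for U
    proof -
      have "closedin K (pts - U)"
        using closedin_diff[OF closedin_topspace U(1)] by simp
      then have "compactin K (pts - U)"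
        by (intro closedin_compact_space compact_K)
      then have "emeasure \<mu> (pts - U) \<le> ?s"
        using U by (intro SUP_upper) auto
      moreover have "pts - U \<in> sets \<mu>"
        using sets.compl_sets[OF open_sets[OF U(1)]] by (simp add: space_\<mu>)
      ultimately have "f (pts - U) \<le> ?s"
        using em by simp
      then have "1 \<le> ?s + \<tau> U"
        using compl[OF open_sets[OF U(1)]] f_open[OF U(1)] add_right_mono[of "f (pts - U)" ?s "\<tau> U"] by simp
      then show ?thesis
        by (simp add: ennreal_minus_le_iff)
    qed
    then have "1 - ?s \<le> f (pts - B)"
      unfolding f_def by (intro INF_greatest) auto
    then have "f (pts - B) + f B \<le> f (pts - B) + ?s"
      using compl[OF B] by (simp add: ennreal_minus_le_iff add.commute)
    moreover have "f (pts - B) \<noteq> \<top>"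
      using f_le_1[of "pts - B"] by (auto simp: top_unique)
    ultimately show "emeasure \<mu> B \<le> ?s"
      using em[OF B] by (simp add: ennreal_add_left_cancel_le)
  qed
  have "\<mu> \<in> radon_probs K"
    using sets_eq prob radon by (auto simp: radon_probs_def)
  moreover have "measure \<mu> (cl A) = m A" if A: "A \<in> M" for A
  proof (rule measure_eq_emeasure_eq_ennreal)
    show "emeasure \<mu> (cl A) = ennreal (m A)"
      using em[OF open_sets[OF openin_cl]] f_open[OF openin_cl] \<tau>_cl[OF A] by simp
    show "0 \<le> m A"
      using m A by (simp add: fin_add_prob_def)
  qed
  ultimately show ?thesis by blast
qed

end

section \<open>Weak* convergence and the hierarchy on clopen sets\<close>

context stone_algebra begin

lemma radon_probsD:
  assumes "\<mu> \<in> radon_probs K"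
  shows "prob_space \<mu>" "sets \<mu> = sets (borel_of K)" "space \<mu> = pts"
  using assms sets_eq_imp_space_eq[of \<mu> "borel_of K"] by (auto simp: radon_probs_def)

lemma fin_add_prob_measure:
  assumes \<mu>: "\<mu> \<in> radon_probs K"
  shows "fin_add_prob (\<lambda>A. measure \<mu> (cl A))"
proof -
  interpret prob_space \<mu> using radon_probsD[OF \<mu>] by simp
  have "measure \<mu> (cl (A \<union> B)) = measure \<mu> (cl A) + measure \<mu> (cl B)"
    if "A \<in> M" "B \<in> M" "A \<inter> B = {}" for A B
  proof -
    have "cl A \<inter> cl B = {}"
      using that cl_Int[of A B] by simp
    then show ?thesis
      using that radon_probsD[OF \<mu>] by (simp add: cl_Un finite_measure_Union cl_sets_borel)
  qed
  then show ?thesis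
    using prob_space radon_probsD[OF \<mu>] by (simp add: fin_add_prob_def)
qed

lemma continuous_map_measurable:
  assumes f: "continuous_map K euclideanreal f" and \<mu>: "sets \<mu> = sets (borel_of K)"
  shows "f \<in> borel_measurable \<mu>"
proof (rule borel_measurableI)
  fix S :: "real set" assume "open S"
  then have "openin K {x \<in> topspace K. f x \<in> S}"
    by (intro openin_continuous_map_preimage[OF f]) simp
  moreover have "{x \<in> topspace K. f x \<in> S} = f -` S \<inter> space \<mu>"
    using sets_eq_imp_space_eq[OF \<mu>] by auto
  ultimately show "f -` S \<inter> space \<mu> \<in> sets \<mu>"
    unfolding \<mu> using openin_sets_borel by simp
qed

lemma continuous_map_bounded:
  assumes f: "continuous_map K euclideanreal f"
  shows "\<exists>b. \<forall>\<phi>\<in>pts. \<bar>f \<phi>\<bar> \<le> b"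
proof -
  have "compactin euclideanreal (f ` pts)"
    using image_compactin[OF _ f, of pts] compact_K by (simp add: compact_space_def)
  then have "bounded (f ` pts)"
    by (simp add: compact_imp_bounded)
  then show ?thesis
    by (auto simp: bounded_iff)
qed

lemma continuous_map_indicator_cl: "continuous_map K euclideanreal (indicator (cl A))"
  unfolding continuous_map_def
proof (intro conjI allI impI)
  fix U :: "real set"
  have "{\<phi> \<in> topspace K. indicator (cl A) \<phi> \<in> U} =
    (if 1 \<in> U then cl A else {}) \<union> (if 0 \<in> U then topspace K - cl A else {})"
    using cl_subset_pts[of A] by (auto simp: indicator_def split: if_splits)
  also have "openin K \<dots>"
    by (intro openin_Un) (simp_all add: openin_cl openin_diff closedin_cl del: topspace_K)
  finally show "openin K {\<phi> \<in> topspace K. indicator (cl A) \<phi> \<in> U}" .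
qed auto

text \<open>Step functions on clopen sets are built one clopen set \<open>A\<close> at a time, by overwriting the
  values on \<open>A\<close>. The convergence claim is localised to all \<open>cl B\<close>
  because the overwritten function is integrated over \<open>cl (B - A)\<close>.\<close>
lemma step_function_approx:
  fixes f :: "('w \<Rightarrow> bool) \<Rightarrow> real"
  assumes \<nu>: "\<And>n. \<nu> n \<in> radon_probs K" and \<mu>: "\<mu> \<in> radon_probs K"
    and lim: "\<And>A. A \<in> M \<Longrightarrow> (\<lambda>n. measure (\<nu> n) (cl A)) \<longlonglongrightarrow> measure \<mu> (cl A)"
    and "finite F" "F \<subseteq> M" "\<And>A. A \<in> F \<Longrightarrow> \<exists>c. \<forall>\<phi>\<in>cl A. \<bar>f \<phi> - c\<bar> \<le> e"
  shows "\<exists>g b. g \<in> borel_measurable (borel_of K) \<and> (\<forall>\<phi>. \<bar>g \<phi>\<bar> \<le> b) \<and>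
     (\<forall>A\<in>F. \<forall>\<phi>\<in>cl A. \<bar>f \<phi> - g \<phi>\<bar> \<le> e) \<and>
     (\<forall>B\<in>M. (\<lambda>n. \<integral>\<phi>. g \<phi> * indicator (cl B) \<phi> \<partial>\<nu> n) \<longlonglongrightarrow> (\<integral>\<phi>. g \<phi> * indicator (cl B) \<phi> \<partial>\<mu>))"
  using assms(4-6)
proof (induction F)
  case empty
  show ?case by (intro exI[of _ "\<lambda>_. 0"]) auto
next
  case (insert A F)
  have "\<exists>g b. g \<in> borel_measurable (borel_of K) \<and> (\<forall>\<phi>. \<bar>g \<phi>\<bar> \<le> b) \<and>
     (\<forall>A\<in>F. \<forall>\<phi>\<in>cl A. \<bar>f \<phi> - g \<phi>\<bar> \<le> e) \<and>
     (\<forall>B\<in>M. (\<lambda>n. \<integral>\<phi>. g \<phi> * indicator (cl B) \<phi> \<partial>\<nu> n) \<longlonglongrightarrow> (\<integral>\<phi>. g \<phi> * indicator (cl B) \<phi> \<partial>\<mu>))"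
    using insert.prems by (intro insert.IH) simp_all
  then obtain g b where g0: "g \<in> borel_measurable (borel_of K)" "\<forall>\<phi>. \<bar>g \<phi>\<bar> \<le> b"
    "\<forall>A\<in>F. \<forall>\<phi>\<in>cl A. \<bar>f \<phi> - g \<phi>\<bar> \<le> e"
    "\<forall>B\<in>M. (\<lambda>n. \<integral>\<phi>. g \<phi> * indicator (cl B) \<phi> \<partial>\<nu> n) \<longlonglongrightarrow> (\<integral>\<phi>. g \<phi> * indicator (cl B) \<phi> \<partial>\<mu>)"
    by (elim exE conjE)
  note g = g0(1) spec[OF g0(2)] bspec[OF bspec[OF g0(3)]] bspec[OF g0(4)]
  obtain c where c: "\<And>\<phi>. \<phi> \<in> cl A \<Longrightarrow> \<bar>f \<phi> - c\<bar> \<le> e"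
    using insert.prems(2)[of A] by auto
  have AM: "A \<in> M" using insert.prems by simp
  define g' where "g' \<phi> = (if \<phi> \<in> cl A then c else g \<phi>)" for \<phi>
  have int: "(\<integral>\<phi>. g' \<phi> * indicator (cl B) \<phi> \<partial>\<rho>) =
      c * measure \<rho> (cl (A \<inter> B)) + (\<integral>\<phi>. g \<phi> * indicator (cl (B - A)) \<phi> \<partial>\<rho>)"
    if \<rho>: "\<rho> \<in> radon_probs K" and B: "B \<in> M" for \<rho> B
  proof -
    interpret prob_space \<rho> using radon_probsD[OF \<rho>] by simp
    note sets = radon_probsD(2)[OF \<rho>]
    have g_meas: "g \<in> borel_measurable \<rho>"
      using g(1) measurable_cong_sets[OF sets refl] by blast
    have "(\<integral>\<phi>. g' \<phi> * indicator (cl B) \<phi> \<partial>\<rho>) =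
        (\<integral>\<phi>. c * indicator (cl (A \<inter> B)) \<phi> + g \<phi> * indicator (cl (B - A)) \<phi> \<partial>\<rho>)"
      using AM B by (intro Bochner_Integration.integral_cong)
        (auto simp: g'_def cl_Int cl_Diff indicator_def)
    also have "\<dots> = (\<integral>\<phi>. c * indicator (cl (A \<inter> B)) \<phi> \<partial>\<rho>) + (\<integral>\<phi>. g \<phi> * indicator (cl (B - A)) \<phi> \<partial>\<rho>)"
    proof (rule Bochner_Integration.integral_add)
      show "integrable \<rho> (\<lambda>\<phi>. c * indicator (cl (A \<inter> B)) \<phi>)"
        using sets cl_sets_borel by (intro integrable_mult_right integrable_real_indicator)
          (auto simp: emeasure_eq_measure)
      show "integrable \<rho> (\<lambda>\<phi>. g \<phi> * indicator (cl (B - A)) \<phi>)"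
      proof (rule integrable_const_bound[of _ "\<bar>b\<bar>"])
        show "AE \<phi> in \<rho>. norm (g \<phi> * indicator (cl (B - A)) \<phi>) \<le> \<bar>b\<bar>"
          using order_trans[OF g(2) abs_ge_self] by (intro AE_I2) (simp add: indicator_def)
        show "(\<lambda>\<phi>. g \<phi> * indicator (cl (B - A)) \<phi>) \<in> borel_measurable \<rho>"
          using g_meas sets cl_sets_borel by simp
      qed
    qed
    also have "(\<integral>\<phi>. c * indicator (cl (A \<inter> B)) \<phi> \<partial>\<rho>) = c * measure \<rho> (cl (A \<inter> B))"
      using radon_probsD(3)[OF \<rho>] cl_subset_pts[of "A \<inter> B"] by (simp add: Int_absorb2)
    finally show ?thesis .
  qed
  have lim': "(\<lambda>n. \<integral>\<phi>. g' \<phi> * indicator (cl B) \<phi> \<partial>\<nu> n) \<longlonglongrightarrow> (\<integral>\<phi>. g' \<phi> * indicator (cl B) \<phi> \<partial>\<mu>)"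
    if B: "B \<in> M" for B
    unfolding int[OF \<nu> B] int[OF \<mu> B]
    using AM B by (intro tendsto_intros lim g) auto
  have "g' \<in> borel_measurable (borel_of K)"
    unfolding g'_def using g(1) cl_sets_borel[of A]
    by (intro measurable_If_set) (simp_all add: Int_absorb2[OF cl_subset_pts])
  moreover have "\<forall>\<phi>. \<bar>g' \<phi>\<bar> \<le> max b \<bar>c\<bar>"
    using g(2) by (simp add: g'_def le_max_iff_disj)
  moreover have "\<forall>A'\<in>insert A F. \<forall>\<phi>\<in>cl A'. \<bar>f \<phi> - g' \<phi>\<bar> \<le> e"
  proof (intro ballI)
    fix A' \<phi> assume "A' \<in> insert A F" "\<phi> \<in> cl A'"
    then show "\<bar>f \<phi> - g' \<phi>\<bar> \<le> e"
      using c[of \<phi>] g(3)[of A' \<phi>] by (cases "\<phi> \<in> cl A") (auto simp: g'_def)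
  qed
  ultimately show ?case
    by (intro exI[of _ g'] exI[of _ "max b \<bar>c\<bar>"] conjI)
      (assumption, assumption, assumption, intro ballI lim')
qed

text \<open>Indicators of clopen sets are continuous, and by compactness continuous functions are
  uniform limits of step functions on clopen sets.\<close>
lemma weak_star_lim_iff:
  assumes \<nu>: "\<And>n. \<nu> n \<in> radon_probs K" and \<mu>: "\<mu> \<in> radon_probs K"
  shows "weak_star_lim K \<nu> \<mu> \<longleftrightarrow> (\<forall>A\<in>M. (\<lambda>n. measure (\<nu> n) (cl A)) \<longlonglongrightarrow> measure \<mu> (cl A))"
proof
  assume w: "weak_star_lim K \<nu> \<mu>"
  have "integral\<^sup>L \<rho> (indicator (cl A)) = measure \<rho> (cl A)" if "\<rho> \<in> radon_probs K" for \<rho> A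
    using radon_probsD(3)[OF that] cl_subset_pts[of A] by (simp add: Int_absorb2)
  note int = this
  show "\<forall>A\<in>M. (\<lambda>n. measure (\<nu> n) (cl A)) \<longlonglongrightarrow> measure \<mu> (cl A)"
  proof
    fix A
    have "(\<lambda>n. integral\<^sup>L (\<nu> n) (indicator (cl A))) \<longlonglongrightarrow> integral\<^sup>L \<mu> (indicator (cl A) :: _ \<Rightarrow> real)"
      using w continuous_map_indicator_cl unfolding weak_star_lim_def by blast
    then show "(\<lambda>n. measure (\<nu> n) (cl A)) \<longlonglongrightarrow> measure \<mu> (cl A)"
      by (simp only: int[OF \<nu>] int[OF \<mu>])
  qed
next
  assume lim: "\<forall>A\<in>M. (\<lambda>n. measure (\<nu> n) (cl A)) \<longlonglongrightarrow> measure \<mu> (cl A)"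
  show "weak_star_lim K \<nu> \<mu>"
    unfolding weak_star_lim_def
  proof (intro allI impI)
    fix f assume f: "continuous_map K euclideanreal f"
    obtain bf where bf: "\<And>\<phi>. \<phi> \<in> pts \<Longrightarrow> \<bar>f \<phi>\<bar> \<le> bf"
      using continuous_map_bounded[OF f] by blast
    show "(\<lambda>n. integral\<^sup>L (\<nu> n) f) \<longlonglongrightarrow> integral\<^sup>L \<mu> f"
    proof (rule LIMSEQ_I)
      fix r :: real assume "0 < r"
      define e where "e = r / 4"
      have e: "0 < e" using \<open>0 < r\<close> by (simp add: e_def)
      define \<F> where "\<F> = {A \<in> M. \<exists>c. \<forall>\<phi>\<in>cl A. \<bar>f \<phi> - c\<bar> \<le> e}"
      have "\<exists>\<G>. finite \<G> \<and> \<G> \<subseteq> cl ` \<F> \<and> topspace K \<subseteq> \<Union>\<G>"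
      proof (rule compactinD)
        show "compactin K (topspace K)"
          using compact_K by (simp only: compact_space_def)
        show "topspace K \<subseteq> \<Union> (cl ` \<F>)"
        proof
          fix \<phi> assume \<phi>: "\<phi> \<in> topspace K"
          have "openin K {\<psi> \<in> topspace K. f \<psi> \<in> ball (f \<phi>) e}"
            by (intro openin_continuous_map_preimage[OF f]) simp
          moreover have "\<phi> \<in> {\<psi> \<in> topspace K. f \<psi> \<in> ball (f \<phi>) e}"
            using \<phi> e by simp
          ultimately obtain A where A: "A \<in> M" "\<phi> \<in> cl A" "cl A \<subseteq> {\<psi> \<in> topspace K. f \<psi> \<in> ball (f \<phi>) e}"
            using cl_base by blast
          then have "\<forall>\<psi>\<in>cl A. \<bar>f \<psi> - f \<phi>\<bar> \<le> e"
            by (auto simp: dist_real_def abs_minus_commute subset_iff)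
          then show "\<phi> \<in> \<Union> (cl ` \<F>)"
            using A by (auto simp: \<F>_def)
        qed
      qed (auto simp: openin_cl)
      then obtain F where F: "finite F" "F \<subseteq> \<F>" "pts \<subseteq> (\<Union>A\<in>F. cl A)"
        by (metis finite_subset_image topspace_K)
      have "\<exists>g b. g \<in> borel_measurable (borel_of K) \<and> (\<forall>\<phi>. \<bar>g \<phi>\<bar> \<le> b) \<and>
         (\<forall>A\<in>F. \<forall>\<phi>\<in>cl A. \<bar>f \<phi> - g \<phi>\<bar> \<le> e) \<and>
         (\<forall>B\<in>M. (\<lambda>n. \<integral>\<phi>. g \<phi> * indicator (cl B) \<phi> \<partial>\<nu> n) \<longlonglongrightarrow> (\<integral>\<phi>. g \<phi> * indicator (cl B) \<phi> \<partial>\<mu>))"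
        using F(2) by (intro step_function_approx[OF \<nu> \<mu> bspec[OF lim] F(1)]) (auto simp: \<F>_def)
      then obtain g b where g0: "g \<in> borel_measurable (borel_of K)" "\<forall>\<phi>. \<bar>g \<phi>\<bar> \<le> b"
        "\<forall>A\<in>F. \<forall>\<phi>\<in>cl A. \<bar>f \<phi> - g \<phi>\<bar> \<le> e"
        "\<forall>B\<in>M. (\<lambda>n. \<integral>\<phi>. g \<phi> * indicator (cl B) \<phi> \<partial>\<nu> n) \<longlonglongrightarrow> (\<integral>\<phi>. g \<phi> * indicator (cl B) \<phi> \<partial>\<mu>)"
        by (elim exE conjE)
      note g = g0(1) spec[OF g0(2)] bspec[OF bspec[OF g0(3)]] bspec[OF g0(4)]
      define g' where "g' \<phi> = g \<phi> * indicator (cl \<Omega>) \<phi>" for \<phi>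
      have g'_close: "\<bar>f \<phi> - g' \<phi>\<bar> \<le> e" if "\<phi> \<in> pts" for \<phi>
        using F(3) g(3) that by (auto simp: g'_def)
      have close: "\<bar>integral\<^sup>L \<rho> f - integral\<^sup>L \<rho> g'\<bar> \<le> e" if \<rho>: "\<rho> \<in> radon_probs K" for \<rho>
      proof -
        interpret prob_space \<rho> using radon_probsD[OF \<rho>] by simp
        note sets = radon_probsD(2)[OF \<rho>] and space = radon_probsD(3)[OF \<rho>]
        have f_meas: "f \<in> borel_measurable \<rho>"
          by (rule continuous_map_measurable[OF f sets])
        have "g \<in> borel_measurable \<rho>"
          using g(1) measurable_cong_sets[OF sets refl] by blast
        then have g_meas: "g' \<in> borel_measurable \<rho>"
          unfolding g'_def using sets cl_sets_borel[of \<Omega>] by simp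
        have if': "integrable \<rho> f"
          using bf space by (intro integrable_const_bound[of _ bf] f_meas AE_I2) auto
        have ig: "integrable \<rho> g'"
        proof (rule integrable_const_bound[of _ "\<bar>b\<bar>"])
          show "AE \<phi> in \<rho>. norm (g' \<phi>) \<le> \<bar>b\<bar>"
            using order_trans[OF g(2) abs_ge_self] by (intro AE_I2) (simp add: g'_def indicator_def)
        qed (rule g_meas)
        have "\<bar>integral\<^sup>L \<rho> f - integral\<^sup>L \<rho> g'\<bar> = \<bar>\<integral>\<phi>. f \<phi> - g' \<phi> \<partial>\<rho>\<bar>"
          using if' ig by simp
        also have "\<dots> \<le> (\<integral>\<phi>. \<bar>f \<phi> - g' \<phi>\<bar> \<partial>\<rho>)"
          by (rule integral_abs_bound)
        also have "\<dots> \<le> e"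
          using if' ig g'_close space by (intro integral_le_const AE_I2) auto
        finally show ?thesis .
      qed
      have "(\<lambda>n. integral\<^sup>L (\<nu> n) g') \<longlonglongrightarrow> integral\<^sup>L \<mu> g'"
        using g(4)[OF top] unfolding g'_def .
      then obtain N where N: "\<And>n. n \<ge> N \<Longrightarrow> \<bar>integral\<^sup>L (\<nu> n) g' - integral\<^sup>L \<mu> g'\<bar> < e"
        using LIMSEQ_D[OF _ e] by (metis real_norm_def)
      have "norm (integral\<^sup>L (\<nu> n) f - integral\<^sup>L \<mu> f) < r" if "n \<ge> N" for n
        using N[OF that] close[OF \<nu>, of n] close[OF \<mu>] e unfolding e_def real_norm_def by linarith
      then show "\<exists>N. \<forall>n\<ge>N. norm (integral\<^sup>L (\<nu> n) f - integral\<^sup>L \<mu> f) < r"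
        by blast
    qed
  qed
qed

lemma closedin_sets_borel: "closedin K C \<Longrightarrow> C \<in> sets (borel_of K)"
proof -
  assume C: "closedin K C"
  have "C = pts - (pts - C)"
    using closedin_subset[OF C] by auto
  moreover have "pts - (pts - C) \<in> sets (borel_of K)"
    using sets.compl_sets[OF openin_sets_borel[OF openin_diff[OF openin_topspace C]]] by simp
  ultimately show ?thesis by simp
qed

text \<open>The map \<open>h\<close> may identify points; the image distribution then carries the right weights.\<close>
lemma distr_pmf_conv_diracs:
  assumes fin: "finite (set_pmf q)" and h: "\<And>x. h x \<in> pts"
  shows "distr (measure_pmf q) (borel_of K) h \<in> conv_diracs K (topspace K)"
proof -
  define \<mu> where "\<mu> = distr (measure_pmf q) (borel_of K) h"
  define p where "p = map_pmf h q"
  have h_meas: "h \<in> measurable (measure_pmf q) (borel_of K)"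
    using h by simp
  have em: "emeasure \<mu> B = emeasure (measure_pmf p) B" if "B \<in> sets (borel_of K)" for B
    unfolding \<mu>_def p_def map_pmf_rep_eq using that h_meas by (simp add: emeasure_distr)
  then have meas: "measure \<mu> B = measure (measure_pmf p) B" if "B \<in> sets (borel_of K)" for B
    using that by (simp add: measure_def)
  have F: "finite (set_pmf p)" "set_pmf p \<subseteq> pts"
    using fin h by (auto simp: p_def)
  have sets: "sets \<mu> = sets (borel_of K)"
    by (simp add: \<mu>_def)
  have prob: "prob_space \<mu>"
    unfolding \<mu>_def by (intro measure_pmf.prob_space_distr h_meas)
  have radon: "emeasure \<mu> B = (SUP C\<in>{C. compactin K C \<and> C \<subseteq> B}. emeasure \<mu> C)" if B: "B \<in> sets \<mu>" for B
  proof (rule antisym)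
    show "(SUP C\<in>{C. compactin K C \<and> C \<subseteq> B}. emeasure \<mu> C) \<le> emeasure \<mu> B"
      using B by (intro SUP_least emeasure_mono) auto
    have C: "compactin K (B \<inter> set_pmf p)"
      using F by (intro finite_imp_compactin) auto
    then have "closedin K (B \<inter> set_pmf p)"
      using Hausdorff_K by (rule compactin_imp_closedin[rotated])
    then have "emeasure \<mu> B = emeasure \<mu> (B \<inter> set_pmf p)"
      using B em closedin_sets_borel by (simp add: sets emeasure_Int_set_pmf)
    then show "emeasure \<mu> B \<le> (SUP C\<in>{C. compactin K C \<and> C \<subseteq> B}. emeasure \<mu> C)"
      using C by (auto intro!: SUP_upper)
  qed
  have comb: "measure \<mu> B = (\<Sum>x\<in>set_pmf p. pmf p x * measure (return (borel_of K) x) B)" if B: "B \<in> sets \<mu>" for B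
  proof -
    have "measure \<mu> B = measure (measure_pmf p) (B \<inter> set_pmf p)"
      using meas B sets by (simp add: measure_Int_set_pmf)
    also have "\<dots> = (\<Sum>x\<in>B \<inter> set_pmf p. pmf p x)"
      using F by (intro measure_measure_pmf_finite) simp
    also have "\<dots> = (\<Sum>x\<in>set_pmf p. pmf p x * indicator B x)"
      using F by (simp add: sum.inter_restrict[symmetric] indicator_def if_distrib Int_commute cong: if_cong)
    also have "\<dots> = (\<Sum>x\<in>set_pmf p. pmf p x * measure (return (borel_of K) x) B)"
      using B sets by (simp add: measure_return)
    finally show ?thesis .
  qed
  have "\<mu> \<in> conv_diracs K (topspace K)"
    unfolding conv_diracs_def radon_probs_def
    using sets prob radon F comb sum_pmf_eq_1[OF F(1)]
    by (auto intro!: exI[of _ "set_pmf p"] exI[of _ "pmf p"])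
  then show ?thesis unfolding \<mu>_def .
qed

lemma S_subset_radon: "S K E \<beta> \<subseteq> radon_probs K"
  by (subst S.simps) (auto simp: conv_diracs_def)

lemma S_bot: "S K E bot = conv_diracs K E"
  by (subst S.simps) simp

lemma S_not_bot:
  "\<beta> \<noteq> bot \<Longrightarrow> \<mu> \<in> S K E \<beta> \<longleftrightarrow> \<mu> \<in> radon_probs K \<and>
     (\<exists>\<nu>. (\<forall>n. \<exists>\<gamma><\<beta>. \<nu> n \<in> S K E \<gamma>) \<and>
       (\<forall>A\<in>M. (\<lambda>n. measure (\<nu> n) (cl A)) \<longlonglongrightarrow> measure \<mu> (cl A)))"
proof -
  assume \<beta>: "\<beta> \<noteq> bot"
  have "\<mu> \<in> S K E \<beta> \<longleftrightarrow> \<mu> \<in> radon_probs K \<and>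
     (\<exists>\<nu>. (\<forall>n. \<exists>\<gamma>\<in>{..<\<beta>}. \<nu> n \<in> S K E \<gamma>) \<and> weak_star_lim K \<nu> \<mu>)"
    by (subst S.simps) (simp add: \<beta>)
  also have "\<dots> \<longleftrightarrow> \<mu> \<in> radon_probs K \<and>
     (\<exists>\<nu>. (\<forall>n. \<exists>\<gamma>\<in>{..<\<beta>}. \<nu> n \<in> S K E \<gamma>) \<and>
       (\<forall>A\<in>M. (\<lambda>n. measure (\<nu> n) (cl A)) \<longlonglongrightarrow> measure \<mu> (cl A)))"
    using weak_star_lim_iff[of _ \<mu>] S_subset_radon by blast
  finally show ?thesis by (simp add: lessThan_iff Bex_def)
qed

text \<open>If level \<open>\<alpha>\<close> brings nothing new, sequences from later levels are sequences from levels
  below \<open>\<alpha>\<close>, and their limits are in level \<open>\<alpha>\<close>.\<close>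
lemma S_stabilises:
  fixes \<alpha> \<gamma> :: "'o::{wellorder,order_bot}"
  assumes \<alpha>: "\<alpha> \<noteq> bot" and stable: "S K E \<alpha> \<subseteq> (\<Union>\<beta>\<in>{..<\<alpha>}. S K E \<beta>)"
  shows "S K E \<gamma> \<subseteq> (\<Union>\<beta>\<in>{..<\<alpha>}. S K E \<beta>)"
proof (induction \<gamma> rule: less_induct)
  case (less \<gamma>)
  show ?case
  proof (cases "\<gamma> < \<alpha>")
    case False
    then have \<gamma>: "\<gamma> \<noteq> bot"
      using \<alpha> bot.not_eq_extremum[of \<alpha>] by auto
    have "S K E \<gamma> \<subseteq> S K E \<alpha>"
    proof
      fix \<mu> assume "\<mu> \<in> S K E \<gamma>"
      then obtain \<nu> where \<mu>: "\<mu> \<in> radon_probs K" and \<nu>: "\<And>n. \<exists>\<delta><\<gamma>. \<nu> n \<in> S K E \<delta>"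
        and lim: "\<forall>A\<in>M. (\<lambda>n. measure (\<nu> n) (cl A)) \<longlonglongrightarrow> measure \<mu> (cl A)"
        unfolding S_not_bot[OF \<gamma>] by blast
      have "\<exists>\<delta><\<alpha>. \<nu> n \<in> S K E \<delta>" for n
        using \<nu>[of n] less.IH by blast
      then show "\<mu> \<in> S K E \<alpha>"
        unfolding S_not_bot[OF \<alpha>] using \<mu> lim by blast
    qed
    then show ?thesis using stable by (rule order_trans)
  qed blast
qed

end

section \<open>A forest labelled by countable ordinals\<close>

lemma countable_omega1_bounded:
  fixes X :: "omega1 set"
  assumes "countable X"
  shows "\<exists>\<gamma>. \<forall>x\<in>X. x < \<gamma>"
proof (rule ccontr)
  assume "\<not> ?thesis"
  then have "UNIV = (\<Union>x\<in>X. {..<x} \<union> {x})"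
    by (force simp: not_less le_less)
  moreover have "countable (\<Union>x\<in>X. {..<x} \<union> {x})"
    using assms countable_lessThan_omega1 by (intro countable_UN) auto
  ultimately show False
    using uncountable_omega1 by simp
qed

text \<open>Limits and successors are treated alike: for a successor the sequence is eventually the
  predecessor. This is why the estimate is \<open>\<beta> \<le> e n\<close> and not \<open>\<beta> < e n\<close>.\<close>
lemma fundamental_sequence_exists:
  fixes \<alpha> :: omega1
  assumes "\<alpha> \<noteq> bot"
  shows "\<exists>e :: nat \<Rightarrow> omega1. (\<forall>n. e n < \<alpha>) \<and> (\<forall>\<beta><\<alpha>. \<forall>\<^sub>F n in sequentially. \<beta> \<le> e n)"
proof -
  have ne: "{..<\<alpha>} \<noteq> {}"
    using assms bot.not_eq_extremum[of \<alpha>] by auto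
  define g where "g = from_nat_into {..<\<alpha>}"
  have g: "range g = {..<\<alpha>}"
    unfolding g_def using ne countable_lessThan_omega1 by (rule range_from_nat_into)
  define e where "e n = Max (g ` {..n})" for n
  have "e n \<in> g ` {..n}" for n
    unfolding e_def by (intro Max_in) auto
  then have "e n < \<alpha>" for n
    using g by blast
  moreover have "\<forall>\<^sub>F n in sequentially. \<beta> \<le> e n" if "\<beta> < \<alpha>" for \<beta>
  proof -
    have "\<beta> \<in> range g"
      using that by (simp add: g)
    then obtain k where "\<beta> = g k"
      by (rule rangeE)
    then have "\<beta> \<le> e n" if "n \<ge> k" for n
      using that unfolding e_def by (intro Max_ge) auto
    then show ?thesis
      by (auto simp: eventually_sequentially)
  qed
  ultimately show ?thesis by blast
qed

definition fundamental :: "omega1 \<Rightarrow> nat \<Rightarrow> omega1" where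
  "fundamental \<alpha> = (if \<alpha> = bot then (\<lambda>_. bot) else
     (SOME e. (\<forall>n. e n < \<alpha>) \<and> (\<forall>\<beta><\<alpha>. \<forall>\<^sub>F n in sequentially. \<beta> \<le> e n)))"

lemma fundamental_bot [simp]: "fundamental bot n = bot"
  by (simp add: fundamental_def)

lemma fundamental:
  assumes "\<alpha> \<noteq> bot"
  shows fundamental_less: "fundamental \<alpha> n < \<alpha>"
    and fundamental_cofinal: "\<beta> < \<alpha> \<Longrightarrow> \<forall>\<^sub>F n in sequentially. \<beta> \<le> fundamental \<alpha> n"
  using someI_ex[OF fundamental_sequence_exists[OF assms]] assms
  by (simp_all add: fundamental_def)

text \<open>A node is a tree (named by the label of its root) and a path, the last step first, so that the
  descendants of a node are the nodes whose path has a given suffix. Paths may be continued below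
  leaves; those nodes are again labelled \<open>bot\<close> and behave as further isolated leaves.\<close>
type_synonym node = "omega1 \<times> nat list"

primrec label_from :: "omega1 \<Rightarrow> nat list \<Rightarrow> omega1" where
  "label_from \<alpha> [] = \<alpha>"
| "label_from \<alpha> (n # s) = fundamental (label_from \<alpha> s) n"

definition label :: "node \<Rightarrow> omega1" where
  "label t = label_from (fst t) (snd t)"

definition child :: "node \<Rightarrow> nat \<Rightarrow> node" where
  "child t n = (fst t, n # snd t)"

lemma label_root [simp]: "label (\<alpha>, []) = \<alpha>"
  by (simp add: label_def)

lemma label_child [simp]: "label (child t n) = fundamental (label t) n"
  by (simp add: label_def child_def)

lemma label_append_le: "label (\<alpha>, q @ s) \<le> label (\<alpha>, s)"
proof (induction q)
  case (Cons n q)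
  have "fundamental \<gamma> n \<le> \<gamma>" for \<gamma>
    using fundamental_less[of \<gamma> n] by (cases "\<gamma> = bot") auto
  then have "label (\<alpha>, (n # q) @ s) \<le> label (\<alpha>, q @ s)"
    by (simp add: label_def)
  then show ?case using Cons by (rule order_trans)
qed simp

section \<open>The algebra of a forest\<close>

text \<open>What is needed of Lebesgue measure on \<open>[0, 1)\<close> and the dyadic sets: the measure has no atoms, as
  witnessed by \<open>C\<close>, and on \<open>C\<close> it is a limit of finitely supported measures.\<close>
locale leaf_space = prob_space L + leaf: algebra "space L" C for L :: "'l measure" and C +
  assumes leaf_sets: "C \<subseteq> sets L"
    and leaf_partition: "0 < e \<Longrightarrow> \<exists>P. finite P \<and> P \<subseteq> C \<and> \<Union>P = space L \<and> (\<forall>B\<in>P. prob B \<le> e)"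
    and leaf_uniform: "\<exists>q :: nat \<Rightarrow> 'l pmf. (\<forall>n. finite (set_pmf (q n)) \<and> set_pmf (q n) \<subseteq> space L) \<and>
      (\<forall>B\<in>C. (\<lambda>n. measure_pmf.prob (q n) B) \<longlonglongrightarrow> prob B)"
begin

text \<open>The pseudometric of the measure algebra.\<close>
definition d :: "'l set \<Rightarrow> 'l set \<Rightarrow> real" where
  "d A B = prob ((A - B) \<union> (B - A))"

lemma d_refl [simp]: "d A A = 0"
  by (simp add: d_def)

lemma d_nonneg [simp]: "0 \<le> d A B"
  by (simp add: d_def)

lemma d_sym: "d A B = d B A"
  by (simp add: d_def Un_commute)

lemma d_triangle:
  assumes [measurable]: "A \<in> sets L" "B \<in> sets L" "E \<in> sets L"
  shows "d A E \<le> d A B + d B E"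
proof -
  have "prob ((A - E) \<union> (E - A)) \<le> prob (((A - B) \<union> (B - A)) \<union> ((B - E) \<union> (E - B)))"
    by (intro finite_measure_mono) auto
  also have "\<dots> \<le> d A B + d B E"
    unfolding d_def by (intro measure_Un_le) auto
  finally show ?thesis by (simp add: d_def)
qed

lemma d_Un:
  assumes [measurable]: "A \<in> sets L" "B \<in> sets L" "A' \<in> sets L" "B' \<in> sets L"
  shows "d (A \<union> B) (A' \<union> B') \<le> d A A' + d B B'"
proof -
  have "prob (((A \<union> B) - (A' \<union> B')) \<union> ((A' \<union> B') - (A \<union> B))) \<le>
    prob (((A - A') \<union> (A' - A)) \<union> ((B - B') \<union> (B' - B)))"
    by (intro finite_measure_mono) auto
  also have "\<dots> \<le> d A A' + d B B'"
    unfolding d_def by (intro measure_Un_le) auto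
  finally show ?thesis by (simp add: d_def)
qed

lemma d_compl:
  assumes "A \<subseteq> space L" "B \<subseteq> space L"
  shows "d (space L - A) (space L - B) = d A B"
proof -
  have "(space L - A) - (space L - B) = B - A" "(space L - B) - (space L - A) = A - B"
    using assms by auto
  then show ?thesis by (simp add: d_def Un_commute)
qed

lemma prob_diff_le_d:
  assumes [measurable]: "A \<in> sets L" "B \<in> sets L"
  shows "\<bar>prob A - prob B\<bar> \<le> d A B"
proof -
  have "prob A \<le> prob B + d A B" if [measurable]: "A \<in> sets L" "B \<in> sets L" for A B
  proof -
    have "prob A \<le> prob (B \<union> ((A - B) \<union> (B - A)))"
      by (intro finite_measure_mono) auto
    also have "\<dots> \<le> prob B + d A B"
      unfolding d_def by (intro measure_Un_le) auto
    finally show ?thesis .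
  qed
  from this[of A B] this[of B A] show ?thesis
    using assms by (simp add: d_sym[of B A] abs_le_iff)
qed

definition sec :: "(node \<times> 'l) set \<Rightarrow> node \<Rightarrow> 'l set" where
  "sec A t = {x. (t, x) \<in> A}"

lemma sec_simps [simp]:
  "sec {} t = {}" "sec (A \<union> B) t = sec A t \<union> sec B t" "sec (A - B) t = sec A t - sec B t"
  "sec (A \<inter> B) t = sec A t \<inter> sec B t" "sec (\<Union>i\<in>I. F i) t = (\<Union>i\<in>I. sec (F i) t)"
  "sec (UNIV \<times> B') t = B'"
  by (auto simp: sec_def)

lemma sec_mono: "A \<subseteq> B \<Longrightarrow> sec A t \<subseteq> sec B t"
  by (auto simp: sec_def)

definition Z :: "(node \<times> 'l) set" where
  "Z = UNIV \<times> space L"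

text \<open>A set is in \<open>\<A>\<close> if \<open>t \<mapsto> sec A t\<close> is continuous into the measure algebra, where each inner node is
  the limit of its children, and takes leaves to \<open>C\<close>. Sets are used rather than classes modulo null sets,
  so that \<open>\<A>\<close> is an algebra of sets.\<close>
definition \<A> :: "(node \<times> 'l) set set" where
  "\<A> = {A. A \<subseteq> Z \<and> (\<forall>t. sec A t \<in> sets L) \<and> (\<forall>t. label t = bot \<longrightarrow> sec A t \<in> C) \<and>
     (\<forall>t. label t \<noteq> bot \<longrightarrow> (\<lambda>n. d (sec A (child t n)) (sec A t)) \<longlonglongrightarrow> 0)}"

lemma \<A>I:
  assumes "A \<subseteq> Z" "\<And>t. sec A t \<in> sets L" "\<And>t. label t = bot \<Longrightarrow> sec A t \<in> C"
    "\<And>t. label t \<noteq> bot \<Longrightarrow> (\<lambda>n. d (sec A (child t n)) (sec A t)) \<longlonglongrightarrow> 0"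
  shows "A \<in> \<A>"
  using assms by (simp add: \<A>_def)

lemma \<A>D:
  assumes "A \<in> \<A>"
  shows "A \<subseteq> Z" "sec A t \<in> sets L" "sec A t \<subseteq> space L" "label t = bot \<Longrightarrow> sec A t \<in> C"
    "label t \<noteq> bot \<Longrightarrow> (\<lambda>n. d (sec A (child t n)) (sec A t)) \<longlonglongrightarrow> 0"
proof -
  have *: "A \<subseteq> Z \<and> (\<forall>t. sec A t \<in> sets L) \<and> (\<forall>t. label t = bot \<longrightarrow> sec A t \<in> C) \<and>
     (\<forall>t. label t \<noteq> bot \<longrightarrow> (\<lambda>n. d (sec A (child t n)) (sec A t)) \<longlonglongrightarrow> 0)"
    using assms unfolding \<A>_def by (rule CollectD)
  then show "A \<subseteq> Z" "sec A t \<in> sets L" "label t = bot \<Longrightarrow> sec A t \<in> C"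
    "label t \<noteq> bot \<Longrightarrow> (\<lambda>n. d (sec A (child t n)) (sec A t)) \<longlonglongrightarrow> 0"
    by blast+
  then show "sec A t \<subseteq> space L"
    by (intro sets.sets_into_space)
qed

lemma algebra_\<A>: "algebra Z \<A>"
  unfolding algebra_iff_Un
proof (intro conjI ballI allI impI)
  show "\<A> \<subseteq> Pow Z" by (auto simp: \<A>_def)
  show "{} \<in> \<A>" by (rule \<A>I) auto
next
  fix A assume A: "A \<in> \<A>"
  have sec: "sec (Z - A) t = space L - sec A t" for t
    by (simp add: Z_def)
  show "Z - A \<in> \<A>"
  proof (rule \<A>I)
    show "Z - A \<subseteq> Z" by (rule Diff_subset)
    show "sec (Z - A) t \<in> sets L" for t
      unfolding sec by (intro sets.compl_sets \<A>D(2)[OF A])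
    show "sec (Z - A) t \<in> C" if "label t = bot" for t
      unfolding sec by (intro leaf.compl_sets \<A>D(4)[OF A that])
    show "(\<lambda>n. d (sec (Z - A) (child t n)) (sec (Z - A) t)) \<longlonglongrightarrow> 0" if "label t \<noteq> bot" for t
      unfolding sec d_compl[OF \<A>D(3)[OF A] \<A>D(3)[OF A]] by (rule \<A>D(5)[OF A that])
  qed
next
  fix A B assume A: "A \<in> \<A>" and B: "B \<in> \<A>"
  note AD = \<A>D[OF A] and BD = \<A>D[OF B]
  show "A \<union> B \<in> \<A>"
  proof (rule \<A>I)
    fix t assume t: "label t \<noteq> bot"
    show "(\<lambda>n. d (sec (A \<union> B) (child t n)) (sec (A \<union> B) t)) \<longlonglongrightarrow> 0"
    proof (rule tendsto_sandwich[where f = "\<lambda>_. 0"])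
      show "(\<lambda>n. d (sec A (child t n)) (sec A t) + d (sec B (child t n)) (sec B t)) \<longlonglongrightarrow> 0"
        using tendsto_add[OF AD(5)[OF t] BD(5)[OF t]] by simp
      show "\<forall>\<^sub>F n in sequentially. d (sec (A \<union> B) (child t n)) (sec (A \<union> B) t)
          \<le> d (sec A (child t n)) (sec A t) + d (sec B (child t n)) (sec B t)"
        unfolding sec_simps by (intro always_eventually allI d_Un AD(2) BD(2))
    qed simp_all
  next
    show "A \<union> B \<subseteq> Z" using AD(1) BD(1) by (rule Un_least)
    show "sec (A \<union> B) t \<in> sets L" for t
      unfolding sec_simps by (intro sets.Un AD(2) BD(2))
    show "sec (A \<union> B) t \<in> C" if "label t = bot" for t
      unfolding sec_simps by (intro leaf.Un AD(4) BD(4) that)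
  qed
qed

lemma constant_in_\<A>: "B \<in> C \<Longrightarrow> UNIV \<times> B \<in> \<A>"
  using leaf_sets leaf.sets_into_space by (intro \<A>I) (auto simp: Z_def)

definition subtree :: "omega1 \<Rightarrow> nat list \<Rightarrow> (node \<times> 'l) set" where
  "subtree \<alpha> s = {((\<alpha>, q @ s), x) | q x. x \<in> space L}"

lemma sec_subtree: "sec (subtree \<alpha> s) t = (if fst t = \<alpha> \<and> suffix s (snd t) then space L else {})"
  by (cases t) (auto simp: sec_def subtree_def suffix_def)

text \<open>A node outside the subtree has at most one child inside, which does not affect the limit.\<close>
lemma subtree_in_\<A>: "subtree \<alpha> s \<in> \<A>"
proof (rule \<A>I)
  fix t :: node
  have "\<forall>\<^sub>F n in sequentially. sec (subtree \<alpha> s) (child t n) = sec (subtree \<alpha> s) t"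
    unfolding eventually_sequentially
  proof (intro exI allI impI)
    fix n assume "n \<ge> Suc (hd s)"
    then show "sec (subtree \<alpha> s) (child t n) = sec (subtree \<alpha> s) t"
      by (cases s) (simp_all add: sec_subtree child_def suffix_Cons)
  qed
  then have "\<forall>\<^sub>F n in sequentially. d (sec (subtree \<alpha> s) (child t n)) (sec (subtree \<alpha> s) t) = 0"
    by eventually_elim simp
  then show "(\<lambda>n. d (sec (subtree \<alpha> s) (child t n)) (sec (subtree \<alpha> s) t)) \<longlonglongrightarrow> 0"
    by (rule tendsto_eventually)
next
  show "subtree \<alpha> s \<subseteq> Z"
    by (auto simp: subtree_def Z_def)
qed (simp_all add: sec_subtree)

end

section \<open>Measures of low level have small support\<close>

locale measure_forest = leaf_space L C for L :: "'l measure" and C +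
  fixes code :: "(node \<times> 'l) set \<Rightarrow> 'w"
  assumes inj_code_forest: "inj_on code \<A>"
begin

sublocale stone_algebra Z \<A> code
  using algebra_\<A> inj_code_forest by (intro stone_algebra.intro) (simp_all add: stone_algebra_axioms_def)

text \<open>The invariant behind the lower bound. Smallness is claimed only where the label is above \<open>\<beta>\<close>: a
  measure in \<open>S\<^sub>\<beta>\<close> may well be the Lebesgue measure of a node of low label.\<close>
lemma small_support:
  assumes "\<mu> \<in> S K (topspace K) \<beta>" "0 < e"
  shows "\<exists>A\<in>\<A>. A \<subseteq> subtree \<alpha> [] \<and> measure \<mu> (cl (subtree \<alpha> [] - A)) \<le> e \<and>
    (\<forall>s. \<beta> < label (\<alpha>, s) \<longrightarrow> prob (sec A (\<alpha>, s)) \<le> e)"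
  using assms
proof (induction \<beta> arbitrary: \<mu> e rule: less_induct)
  case (less \<beta>)
  note e = \<open>0 < e\<close>
  have \<mu>: "\<mu> \<in> radon_probs K"
    using less.prems(1) S_subset_radon by blast
  note sets_\<mu> = radon_probsD(2)[OF \<mu>]
  have tree: "subtree \<alpha> s \<in> \<A>" for s
    by (rule subtree_in_\<A>)
  show ?case
  proof (cases "\<beta> = bot")
    case True
    then obtain F c where F: "finite F" "F \<subseteq> pts"
      and meas: "\<And>B. B \<in> sets \<mu> \<Longrightarrow> measure \<mu> B = (\<Sum>x\<in>F. c x * measure (return (borel_of K) x) B)"
      using less.prems(1) by (auto simp: S_bot conv_diracs_def)
    \<comment> \<open>Each of the \<open>card F\<close> points lies over one piece of a partition of \<open>space L\<close>; the summand 1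
      keeps the bound positive when \<open>F\<close> is empty.\<close>
    define e' where "e' = e / (card F + 1)"
    have "0 < e'" using e by (simp add: e'_def)
    then obtain P where P0: "finite P" "P \<subseteq> C" "\<Union>P = space L" "\<forall>B\<in>P. prob B \<le> e'"
      using leaf_partition by meson
    note P = P0(1-3) bspec[OF P0(4)]
    have const: "UNIV \<times> B \<in> \<A>" if "B \<in> P" for B
      using that P(2) by (intro constant_in_\<A>) (rule subsetD)
    have "\<exists>B\<in>P. \<phi> \<in> cl (UNIV \<times> B)" if "\<phi> \<in> F" for \<phi>
    proof -
      have "(\<Union>B\<in>P. UNIV \<times> B) = Z"
        using P(3) by (auto simp: Z_def)
      then have "(\<Union>B\<in>P. cl (UNIV \<times> B)) = pts"
        using cl_finite_UN[OF P(1), of "\<lambda>B. UNIV \<times> B"] const by simp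
      then show ?thesis using that F by blast
    qed
    then obtain p where p: "\<And>\<phi>. \<phi> \<in> F \<Longrightarrow> p \<phi> \<in> P" "\<And>\<phi>. \<phi> \<in> F \<Longrightarrow> \<phi> \<in> cl (UNIV \<times> p \<phi>)"
      by metis
    define E where "E = (\<Union>\<phi>\<in>F. UNIV \<times> p \<phi> :: (node \<times> 'l) set)"
    have E: "E \<in> \<A>" "cl E = (\<Union>\<phi>\<in>F. cl (UNIV \<times> p \<phi>))"
      unfolding E_def using cl_finite_UN[OF F(1), of "\<lambda>\<phi>. UNIV \<times> p \<phi>"] const p by auto
    define A where "A = subtree \<alpha> [] \<inter> E"
    have "subtree \<alpha> [] - A = subtree \<alpha> [] - E"
      by (auto simp: A_def)
    then have "cl (subtree \<alpha> [] - A) \<inter> F = {}"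
      using E p by (auto simp: cl_Diff tree)
    then have "measure \<mu> (cl (subtree \<alpha> [] - A)) = 0"
      using meas[of "cl (subtree \<alpha> [] - A)"] cl_sets_borel[of "subtree \<alpha> [] - A"]
      by (subst meas) (auto simp: sets_\<mu> measure_return indicator_def intro!: sum.neutral)
    moreover have "prob (sec A t) \<le> e" for t
    proof -
      have pC: "p \<phi> \<in> sets L" if "\<phi> \<in> F" for \<phi>
        using p(1)[OF that] P(2) leaf_sets by blast
      have "prob (sec A t) \<le> prob (\<Union>\<phi>\<in>F. p \<phi>)"
        using pC F(1) by (intro finite_measure_mono) (auto simp: A_def E_def)
      also have "\<dots> \<le> (\<Sum>\<phi>\<in>F. prob (p \<phi>))"
        using pC F(1) by (intro finite_measure_subadditive_finite) auto
      also have "\<dots> \<le> (\<Sum>\<phi>\<in>F. e')"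
        using p P by (intro sum_mono) auto
      also have "\<dots> \<le> e"
        using e by (simp add: e'_def field_simps)
      finally show ?thesis .
    qed
    moreover have "A \<in> \<A>" "A \<subseteq> subtree \<alpha> []"
      using E(1) tree by (auto simp: A_def)
    ultimately show ?thesis
      using e by (intro bexI[of _ A]) auto
  next
    case False
    then obtain \<nu> \<gamma> where \<gamma>: "\<And>n. \<gamma> n < \<beta>" and \<nu>: "\<And>n. \<nu> n \<in> S K (topspace K) (\<gamma> n)"
      and lim: "\<And>A. A \<in> \<A> \<Longrightarrow> (\<lambda>n. measure (\<nu> n) (cl A)) \<longlonglongrightarrow> measure \<mu> (cl A)"
      using less.prems(1) unfolding S_not_bot[OF False] by metis
    define m where "m A = measure \<mu> (cl A)" for A
    define m' where "m' n A = measure (\<nu> n) (cl A)" for n A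
    have m: "fin_add_prob m"
      unfolding m_def by (rule fin_add_prob_measure[OF \<mu>])
    have m': "fin_add_prob (m' n)" for n
      unfolding m'_def using \<nu> S_subset_radon by (intro fin_add_prob_measure) blast
    have lim': "(\<lambda>n. m' n A) \<longlonglongrightarrow> m A" if "A \<in> \<A>" for A
      unfolding m'_def m_def by (rule lim[OF that])
    \<comment> \<open>\<open>D k\<close> exhausts the part of the tree with labels at most \<open>\<beta>\<close>. Beyond some \<open>D N\<close> it carries
      almost no mass of \<open>\<mu>\<close>, and hence almost none of suitable members of the sequence.\<close>
    define low where "low k = {i. i \<le> k \<and> label (\<alpha>, from_nat i) \<le> \<beta>}" for k
    define D where "D k = (\<Union>i\<in>low k. subtree \<alpha> (from_nat i))" for k
    have "finite (low k)" for k
      by (simp add: low_def)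
    then have D: "D k \<in> \<A>" for k
      unfolding D_def using tree by (intro finite_UN) auto
    have D_mono: "D k \<subseteq> D k'" if "k \<le> k'" for k k'
      unfolding D_def using that by (intro UN_mono) (auto simp: low_def)
    have "incseq (\<lambda>k. m (D k))"
      by (intro incseq_SucI fin_add_prob_mono[OF m] D D_mono) simp
    moreover have "m (D k) \<le> m Z" for k
      using D \<A>D(1)[OF D] by (intro fin_add_prob_mono[OF m]) auto
    ultimately obtain l where l: "(\<lambda>k. m (D k)) \<longlonglongrightarrow> l" "\<forall>k. m (D k) \<le> l"
      by (elim incseq_convergent) auto
    have "\<forall>\<^sub>F k in sequentially. l - e / 4 < m (D k)"
      using e by (intro order_tendstoD(1)[OF l(1)]) simp
    then obtain N where "l - e / 4 < m (D N)"
      unfolding eventually_sequentially by blast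
    then have N: "m (D k) - m (D N) < e / 4" for k
      using l(2)[rule_format, of k] by linarith
    have "\<exists>j\<ge>k. m' j (D (N + k) - D N) < e / 4" for k
    proof -
      have "m (D (N + k) - D N) < e / 4"
        using N[of "N + k"] fin_add_prob_mono(1)[OF m D D D_mono, of N "N + k"] by simp
      then have "\<forall>\<^sub>F j in sequentially. m' j (D (N + k) - D N) < e / 4"
        using lim'[of "D (N + k) - D N"] D by (intro order_tendstoD(2)) auto
      then obtain j0 where "\<forall>j\<ge>j0. m' j (D (N + k) - D N) < e / 4"
        unfolding eventually_sequentially by blast
      then show ?thesis
        by (intro exI[of _ "max j0 k"]) simp
    qed
    then obtain j where j: "\<And>k. j k \<ge> k" "\<And>k. m' (j k) (D (N + k) - D N) < e / 4"
      by metis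
    define \<epsilon> where "\<epsilon> k = e / 4 * (1/2) ^ Suc k" for k
    have \<epsilon>_pos: "0 < \<epsilon> k" and \<epsilon>_le: "\<epsilon> k \<le> e / 4" for k
    proof -
      show "0 < \<epsilon> k" using e by (simp add: \<epsilon>_def)
      have "(1/2 :: real) ^ Suc k \<le> 1" by (rule power_le_one) auto
      then show "\<epsilon> k \<le> e / 4" using e mult_left_le[of "(1/2) ^ Suc k" "e / 4"] by (simp add: \<epsilon>_def)
    qed
    have \<epsilon>_tail: "(\<lambda>i. \<epsilon> (i + n)) sums (e / 4 * (1/2) ^ n)" for n
    proof -
      have "(\<lambda>i. e / 4 * (1/2) ^ n * (1/2) ^ Suc i) sums (e / 4 * (1/2) ^ n * 1)"
        by (intro sums_mult power_half_series)
      moreover have "e / 4 * (1/2) ^ n * (1/2) ^ Suc i = \<epsilon> (i + n)" for i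
        by (simp add: \<epsilon>_def power_add)
      ultimately show ?thesis by simp
    qed
    have "\<exists>A\<in>\<A>. A \<subseteq> subtree \<alpha> [] \<and> m' (j k) (subtree \<alpha> [] - A) \<le> \<epsilon> k \<and>
        (\<forall>s. \<gamma> (j k) < label (\<alpha>, s) \<longrightarrow> prob (sec A (\<alpha>, s)) \<le> \<epsilon> k)" for k
      unfolding m'_def by (intro less.IH \<gamma> \<nu> \<epsilon>_pos)
    then obtain A where A: "\<And>k. A k \<in> \<A>" "\<And>k. A k \<subseteq> subtree \<alpha> []"
        "\<And>k. m' (j k) (subtree \<alpha> [] - A k) \<le> \<epsilon> k"
        "\<And>k s. \<gamma> (j k) < label (\<alpha>, s) \<Longrightarrow> prob (sec (A k) (\<alpha>, s)) \<le> \<epsilon> k"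
      by metis
    \<comment> \<open>At a low node only finitely many of the \<open>A' k\<close> are nonempty.\<close>
    define A' where "A' k = A k - D (N + k)" for k
    have A': "A' k \<in> \<A>" for k
      using A(1) D by (auto simp: A'_def)
    define E where "E n = D N \<union> (\<Union>k<n. A' k)" for n
    have E: "E n \<in> \<A>" for n
      using D A' by (auto simp: E_def intro!: finite_UN)
    define B where "B = D N \<union> (\<Union>k. A' k)"
    have E_sub_B: "E n \<subseteq> B" for n
      by (auto simp: E_def B_def)
    have sec_B [measurable]: "sec B t \<in> sets L" for t
      using \<A>D(2)[OF D] \<A>D(2)[OF A'] by (auto simp: B_def)
    have sec_E [measurable]: "sec (E n) t \<in> sets L" for n t
      by (rule \<A>D(2)[OF E])
    have sec_A [measurable]: "sec (A k) t \<in> sets L" for k t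
      by (rule \<A>D(2)[OF A(1)])
    have D_sub: "D k \<subseteq> subtree \<alpha> []" for k
      by (auto simp: D_def subtree_def)
    have B_sub: "B \<subseteq> subtree \<alpha> []"
      using D_sub A(2) unfolding B_def A'_def by blast
    \<comment> \<open>The finite unions \<open>E n\<close> approximate \<open>B\<close> uniformly over the nodes of label at least \<open>\<beta>\<close>, since the
      levels \<open>\<gamma> (j k)\<close> are below \<open>\<beta>\<close>.\<close>
    have tail: "prob (sec B (\<alpha>, s) - sec (E n) (\<alpha>, s)) \<le> e / 4 * (1/2) ^ n" if s: "\<beta> \<le> label (\<alpha>, s)" for s n
    proof -
      have le: "prob (sec (A (i + n)) (\<alpha>, s)) \<le> \<epsilon> (i + n)" for i
        using s \<gamma> by (intro A(4)) (rule less_le_trans)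
      have summ: "summable (\<lambda>i. prob (sec (A (i + n)) (\<alpha>, s)))"
        using le by (intro summable_comparison_test[OF _ sums_summable[OF \<epsilon>_tail[of n]]]) auto
      have "sec B (\<alpha>, s) - sec (E n) (\<alpha>, s) \<subseteq> (\<Union>i. sec (A (i + n)) (\<alpha>, s))"
      proof
        fix x assume x: "x \<in> sec B (\<alpha>, s) - sec (E n) (\<alpha>, s)"
        then obtain k where k: "x \<in> sec (A' k) (\<alpha>, s)"
          by (auto simp: B_def E_def)
        then have "\<not> k < n" using x by (auto simp: E_def)
        then have "x \<in> sec (A ((k - n) + n)) (\<alpha>, s)"
          using k by (simp add: A'_def)
        then show "x \<in> (\<Union>i. sec (A (i + n)) (\<alpha>, s))" by blast
      qed
      then have "prob (sec B (\<alpha>, s) - sec (E n) (\<alpha>, s)) \<le> prob (\<Union>i. sec (A (i + n)) (\<alpha>, s))"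
        by (intro finite_measure_mono) auto
      also have "\<dots> \<le> (\<Sum>i. prob (sec (A (i + n)) (\<alpha>, s)))"
        using summ by (intro finite_measure_subadditive_countably) auto
      also have "\<dots> \<le> (\<Sum>i. \<epsilon> (i + n))"
        using le summ sums_summable[OF \<epsilon>_tail[of n]] by (intro suminf_le) auto
      also have "\<dots> = e / 4 * (1/2) ^ n"
        using sums_unique[OF \<epsilon>_tail[of n]] by simp
      finally show ?thesis .
    qed
    have low_sec: "sec B (\<alpha>, q @ r) = sec (E (to_nat r)) (\<alpha>, q @ r)" if "label (\<alpha>, r) \<le> \<beta>" for q r
    proof -
      have "sec (A' k) (\<alpha>, q @ r) = {}" if k: "to_nat r \<le> k" for k
      proof -
        have "to_nat r \<in> low (N + k)"
          using k \<open>label (\<alpha>, r) \<le> \<beta>\<close> by (simp add: low_def)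
        then have "subtree \<alpha> r \<subseteq> D (N + k)"
          unfolding D_def using UN_upper[of "to_nat r" "low (N + k)" "\<lambda>i. subtree \<alpha> (from_nat i)"] by simp
        then have "space L \<subseteq> sec (D (N + k)) (\<alpha>, q @ r)"
          using sec_mono[of "subtree \<alpha> r" _ "(\<alpha>, q @ r)"] by (simp add: sec_subtree suffix_def)
        then show ?thesis
          using \<A>D(3)[OF A(1)[of k], of "(\<alpha>, q @ r)"] by (auto simp: A'_def)
      qed
      then show ?thesis
        by (force simp: B_def E_def not_le[symmetric])
    qed
    have other: "sec B t = {}" if "fst t \<noteq> \<alpha>" for t
      using sec_mono[OF B_sub, of t] that by (simp add: sec_subtree)
    have BM: "B \<in> \<A>"
    proof (rule \<A>I)
      show "B \<subseteq> Z"
        using B_sub \<A>D(1)[OF tree] by blast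
      show "sec B t \<in> sets L" for t by (rule sec_B)
      show "sec B t \<in> C" if "label t = bot" for t
      proof (cases "fst t = \<alpha>")
        case True
        then have "sec B t = sec (E (to_nat (snd t))) t"
          using low_sec[of "snd t" "[]"] that by (cases t) simp
        then show ?thesis
          using \<A>D(4)[OF E that] by simp
      qed (simp add: other)
      show "(\<lambda>n. d (sec B (child t n)) (sec B t)) \<longlonglongrightarrow> 0" if t: "label t \<noteq> bot" for t
      proof (cases "fst t = \<alpha>")
        case False
        then show ?thesis by (simp add: other child_def)
      next
        case True
        then obtain r where r: "t = (\<alpha>, r)" by (cases t) auto
        show ?thesis
        proof (cases "label t \<le> \<beta>")
          case True
          have "sec B t = sec (E (to_nat r)) t" "sec B (child t n) = sec (E (to_nat r)) (child t n)" for n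
            using low_sec[of r "[]"] low_sec[of r "[n]"] True by (simp_all add: r child_def)
          then show ?thesis
            using \<A>D(5)[OF E t] by simp
        next
          case False
          have d_tail: "d (sec (E n) (\<alpha>, s)) (sec B (\<alpha>, s)) \<le> e / 4 * (1/2) ^ n" if "\<beta> \<le> label (\<alpha>, s)" for s n
            using tail[OF that, of n] sec_mono[OF E_sub_B, of n "(\<alpha>, s)"]
            by (simp add: d_def Diff_eq_empty_iff[THEN iffD2])
          show ?thesis
          proof (rule LIMSEQ_I)
            fix \<delta> :: real assume \<delta>: "0 < \<delta>"
            have "(\<lambda>n. e / 4 * (1/2) ^ n) \<longlonglongrightarrow> e / 4 * 0"
              by (intro tendsto_intros LIMSEQ_power_zero) auto
            from order_tendstoD(2)[OF this, of "\<delta> / 3"] have "\<forall>\<^sub>F n in sequentially. e / 4 * (1/2) ^ n < \<delta> / 3"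
              using \<delta> by simp
            then obtain n where n: "e / 4 * (1/2) ^ n < \<delta> / 3"
              using eventually_happens by force
            \<comment> \<open>Almost all children of a node with label above \<open>\<beta>\<close> have label at least \<open>\<beta>\<close>, where
              the uniform approximation is available.\<close>
            have ev1: "\<forall>\<^sub>F i in sequentially. \<beta> \<le> label (child t i)"
              using fundamental_cofinal[OF t, of \<beta>] False by simp
            have ev2: "\<forall>\<^sub>F i in sequentially. d (sec (E n) (child t i)) (sec (E n) t) < \<delta> / 3"
              using \<delta> by (intro order_tendstoD(2)[OF \<A>D(5)[OF E t]]) simp
            from ev1 ev2 have "\<forall>\<^sub>F i in sequentially. norm (d (sec B (child t i)) (sec B t) - 0) < \<delta>"
            proof eventually_elim
              case (elim i)
              have "d (sec B (child t i)) (sec B t) \<le> d (sec B (child t i)) (sec (E n) (child t i)) + d (sec (E n) (child t i)) (sec B t)"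
                by (intro d_triangle) auto
              also have "d (sec (E n) (child t i)) (sec B t) \<le> d (sec (E n) (child t i)) (sec (E n) t) + d (sec (E n) t) (sec B t)"
                by (intro d_triangle) auto
              finally have "d (sec B (child t i)) (sec B t) \<le> d (sec (E n) (child t i)) (sec B (child t i)) +
                  (d (sec (E n) (child t i)) (sec (E n) t) + d (sec (E n) t) (sec B t))"
                by (simp add: d_sym)
              moreover have "d (sec (E n) (child t i)) (sec B (child t i)) \<le> e / 4 * (1/2) ^ n"
                using d_tail[of "i # r" n] elim(1) by (simp add: r child_def)
              moreover have "d (sec (E n) t) (sec B t) \<le> e / 4 * (1/2) ^ n"
                using d_tail[of r n] False by (simp add: r)
              ultimately have "d (sec B (child t i)) (sec B t) < \<delta>"
                using n elim(2) by linarith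
              then show ?case by simp
            qed
            then show "\<exists>no. \<forall>i\<ge>no. norm (d (sec B (child t i)) (sec B t) - 0) < \<delta>"
              unfolding eventually_sequentially .
          qed
        qed
      qed
    qed
    have "m (subtree \<alpha> [] - B) \<le> e"
    proof (rule ccontr)
      assume "\<not> m (subtree \<alpha> [] - B) \<le> e"
      then have "\<forall>\<^sub>F i in sequentially. e < m' i (subtree \<alpha> [] - B)"
        using lim'[of "subtree \<alpha> [] - B"] tree BM by (intro order_tendstoD(1)) auto
      then obtain k where k: "\<And>i. i \<ge> k \<Longrightarrow> e < m' i (subtree \<alpha> [] - B)"
        unfolding eventually_sequentially by blast
      have "m' (j k) (subtree \<alpha> [] - B) \<le> m' (j k) ((subtree \<alpha> [] - A k) \<union> (D (N + k) - D N))"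
        by (intro fin_add_prob_mono(2)[OF m'] Un Diff tree BM A(1) D) (auto simp: B_def A'_def)
      also have "\<dots> \<le> m' (j k) (subtree \<alpha> [] - A k) + m' (j k) (D (N + k) - D N)"
        by (intro fin_add_prob_Un_le m' Diff tree A(1) D)
      also have "\<dots> \<le> \<epsilon> k + e / 4"
        using A(3)[of k] j(2)[of k] by linarith
      also have "\<dots> \<le> e"
        using \<epsilon>_le[of k] e by linarith
      finally show False
        using k[OF j(1)[of k]] by linarith
    qed
    moreover have "prob (sec B (\<alpha>, s)) \<le> e" if s: "\<beta> < label (\<alpha>, s)" for s
    proof -
      \<comment> \<open>Labels decrease along branches, so a node with label above \<open>\<beta>\<close> is in no low subtree.\<close>
      have "sec (D N) (\<alpha>, s) = {}"
      proof -
        have "\<not> suffix (from_nat i) s" if "label (\<alpha>, from_nat i) \<le> \<beta>" for i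
          using that s label_append_le[of \<alpha> _ "from_nat i"] by (auto simp: suffix_def dest: leD order_trans)
        then show ?thesis
          by (auto simp: D_def low_def sec_subtree)
      qed
      then have "sec (E 0) (\<alpha>, s) = {}"
        by (simp add: E_def)
      then have "prob (sec B (\<alpha>, s)) \<le> e / 4"
        using tail[of s 0] s by simp
      then show ?thesis using e by simp
    qed
    ultimately show ?thesis
      using BM B_sub unfolding m_def by (intro bexI[of _ B]) auto
  qed
qed

end

section \<open>The measures of the nodes in the hierarchy\<close>

context measure_forest begin

lemma fin_add_prob_node: "fin_add_prob (\<lambda>A. prob (sec A t))"
  unfolding fin_add_prob_def
proof (intro conjI ballI impI)
  show "prob (sec Z t) = 1"
    by (simp add: Z_def prob_space)
  show "prob (sec (A \<union> B) t) = prob (sec A t) + prob (sec B t)"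
    if "A \<in> \<A>" "B \<in> \<A>" "A \<inter> B = {}" for A B
  proof -
    have "sec A t \<inter> sec B t = {}"
      using that by (auto simp: sec_def)
    then show ?thesis
      using that by (simp add: finite_measure_Union \<A>D(2))
  qed
qed simp

text \<open>Induction on the label. At a leaf the equidistributed finite measures converge to the node's measure;
  an inner node is the limit of its children, and countably many levels have a common upper bound.\<close>
lemma node_measure_in_hierarchy:
  assumes "\<mu> \<in> radon_probs K" "\<And>A. A \<in> \<A> \<Longrightarrow> measure \<mu> (cl A) = prob (sec A t)"
  shows "\<exists>\<gamma> :: omega1. \<mu> \<in> S K (topspace K) \<gamma>"
  using assms
proof (induction "label t" arbitrary: t \<mu> rule: less_induct)
  case less
  have "\<exists>\<nu>. (\<forall>n. \<exists>\<gamma> :: omega1. \<nu> n \<in> S K (topspace K) \<gamma>) \<and>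
      (\<forall>A\<in>\<A>. (\<lambda>n. measure (\<nu> n) (cl A)) \<longlonglongrightarrow> prob (sec A t))"
  proof (cases "label t = bot")
    case True
    obtain q :: "nat \<Rightarrow> 'l pmf" where q: "\<And>n. finite (set_pmf (q n))" "\<And>n. set_pmf (q n) \<subseteq> space L"
      "\<And>B. B \<in> C \<Longrightarrow> (\<lambda>n. measure_pmf.prob (q n) B) \<longlonglongrightarrow> prob B"
      using leaf_uniform by metis
    obtain x0 where x0: "x0 \<in> space L"
      using not_empty by blast
    define h where "h x = ev (t, if x \<in> space L then x else x0)" for x
    have h: "h x \<in> pts" for x
      unfolding h_def using x0 by (intro ev_in_pts) (simp add: Z_def)
    define \<nu> where "\<nu> n = distr (measure_pmf (q n)) (borel_of K) h" for n
    have "\<nu> n \<in> S K (topspace K) (bot :: omega1)" for n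
      unfolding S_bot \<nu>_def by (intro distr_pmf_conv_diracs q h)
    moreover have "(\<lambda>n. measure (\<nu> n) (cl A)) \<longlonglongrightarrow> prob (sec A t)" if A: "A \<in> \<A>" for A
    proof -
      have "measure (\<nu> n) (cl A) = measure_pmf.prob (q n) (sec A t)" for n
      proof -
        have "measure (\<nu> n) (cl A) = measure_pmf.prob (q n) (h -` cl A)"
          unfolding \<nu>_def using h cl_sets_borel by (subst measure_distr) auto
        also have "\<dots> = measure_pmf.prob (q n) (sec A t)"
        proof (rule measure_pmf.finite_measure_eq_AE)
          show "AE x in measure_pmf (q n). x \<in> h -` cl A \<longleftrightarrow> x \<in> sec A t"
            unfolding AE_measure_pmf_iff
          proof
            fix x assume "x \<in> set_pmf (q n)"
            then have x: "x \<in> space L" using q(2) by blast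
            then have Z: "(t, x) \<in> Z" by (simp add: Z_def)
            then have "h x \<in> cl A \<longleftrightarrow> (t, x) \<in> A"
              unfolding h_def using ev_in_cl[of "(t, x)" A] A x Z by simp
            then show "x \<in> h -` cl A \<longleftrightarrow> x \<in> sec A t"
              by (simp add: sec_def)
          qed
        qed simp_all
        finally show ?thesis .
      qed
      then show ?thesis
        using q(3)[OF \<A>D(4)[OF A True]] by simp
    qed
    ultimately show ?thesis by blast
  next
    case False
    have "\<exists>\<nu>\<in>radon_probs K. \<forall>A\<in>\<A>. measure \<nu> (cl A) = prob (sec A (child t n))" for n
      by (intro radon_extension fin_add_prob_node)
    then obtain \<nu> where \<nu>: "\<And>n. \<nu> n \<in> radon_probs K"
      "\<And>n A. A \<in> \<A> \<Longrightarrow> measure (\<nu> n) (cl A) = prob (sec A (child t n))"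
      by metis
    have "\<exists>\<gamma> :: omega1. \<nu> n \<in> S K (topspace K) \<gamma>" for n
      using fundamental_less[OF False] by (intro less.hyps[of "child t n"] \<nu>) simp_all
    moreover have "(\<lambda>n. measure (\<nu> n) (cl A)) \<longlonglongrightarrow> prob (sec A t)" if A: "A \<in> \<A>" for A
      unfolding \<nu>(2)[OF A]
    proof (rule LIM_zero_cancel, rule tendsto_rabs_zero_cancel,
        rule tendsto_sandwich[where f = "\<lambda>_. 0"])
      show "\<forall>\<^sub>F n in sequentially. \<bar>prob (sec A (child t n)) - prob (sec A t)\<bar> \<le> d (sec A (child t n)) (sec A t)"
        by (intro always_eventually allI prob_diff_le_d \<A>D(2)[OF A])
      show "(\<lambda>n. d (sec A (child t n)) (sec A t)) \<longlonglongrightarrow> 0"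
        by (rule \<A>D(5)[OF A False])
      show "\<forall>\<^sub>F n in sequentially. 0 \<le> \<bar>prob (sec A (child t n)) - prob (sec A t)\<bar>"
        by simp
    qed simp
    ultimately show ?thesis by blast
  qed
  then obtain \<nu> and \<gamma> :: "nat \<Rightarrow> omega1" where \<nu>: "\<And>n. \<nu> n \<in> S K (topspace K) (\<gamma> n)"
    "\<And>A. A \<in> \<A> \<Longrightarrow> (\<lambda>n. measure (\<nu> n) (cl A)) \<longlonglongrightarrow> prob (sec A t)"
    by metis
  obtain \<delta> where \<delta>: "\<And>n. \<gamma> n < \<delta>"
    using countable_omega1_bounded[of "range \<gamma>"] by auto
  have "\<delta> \<noteq> bot"
    using \<delta>[of 0] by auto
  moreover have "\<exists>\<gamma>'<\<delta>. \<nu> n \<in> S K (topspace K) \<gamma>'" for n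
    using \<nu>(1) \<delta> by blast
  ultimately have "\<mu> \<in> S K (topspace K) \<delta>"
    using less.prems \<nu>(2) by (subst S_not_bot) (auto intro!: exI[of _ \<nu>])
  then show ?case by blast
qed

text \<open>A set cannot have nearly full measure for the root measure and a small section at the root.\<close>
lemma root_measure_not_below:
  assumes \<mu>: "\<And>A. A \<in> \<A> \<Longrightarrow> measure \<mu> (cl A) = prob (sec A (\<alpha>, []))" and \<beta>: "\<beta> < \<alpha>"
  shows "\<mu> \<notin> S K (topspace K) \<beta>"
proof
  assume "\<mu> \<in> S K (topspace K) \<beta>"
  then obtain A where A: "A \<in> \<A>" "measure \<mu> (cl (subtree \<alpha> [] - A)) \<le> 1/3"
    "\<And>s. \<beta> < label (\<alpha>, s) \<Longrightarrow> prob (sec A (\<alpha>, s)) \<le> 1/3"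
    using small_support[of \<mu> \<beta> "1/3" \<alpha>] by auto
  have "prob (sec A (\<alpha>, [])) \<le> 1/3"
    using A(3)[of "[]"] \<beta> by simp
  moreover have "prob (space L - sec A (\<alpha>, [])) \<le> 1/3"
    using A(1,2) \<mu>[of "subtree \<alpha> [] - A"] subtree_in_\<A> by (simp add: sec_subtree Diff)
  ultimately show False
    using prob_compl[OF \<A>D(2)[OF A(1), of "(\<alpha>, [])"]] by simp
qed

text \<open>The root of the tree of \<open>\<alpha>\<close> enters the hierarchy, but not below \<open>\<alpha>\<close>.\<close>
theorem hierarchy_strict:
  fixes \<alpha> :: omega1
  assumes \<alpha>: "\<alpha> \<noteq> bot"
  shows "S K (topspace K) \<alpha> - (\<Union>\<beta>\<in>{..<\<alpha>}. S K (topspace K) \<beta>) \<noteq> {}"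
proof
  assume "S K (topspace K) \<alpha> - (\<Union>\<beta>\<in>{..<\<alpha>}. S K (topspace K) \<beta>) = {}"
  then have "S K (topspace K) \<alpha> \<subseteq> (\<Union>\<beta>\<in>{..<\<alpha>}. S K (topspace K) \<beta>)"
    by blast
  note stable = S_stabilises[OF \<alpha> this]
  obtain \<mu> where \<mu>: "\<mu> \<in> radon_probs K" "\<And>A. A \<in> \<A> \<Longrightarrow> measure \<mu> (cl A) = prob (sec A (\<alpha>, []))"
    using radon_extension[OF fin_add_prob_node[of "(\<alpha>, [])"]] by blast
  obtain \<gamma> :: omega1 where "\<mu> \<in> S K (topspace K) \<gamma>"
    using node_measure_in_hierarchy[OF \<mu>] by blast
  then obtain \<beta> where "\<beta> < \<alpha>" "\<mu> \<in> S K (topspace K) \<beta>"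
    using stable by blast
  then show False
    using root_measure_not_below[OF \<mu>(2)] by blast
qed

end

section \<open>Lebesgue measure on the dyadic sets\<close>

definition dyadic_determined :: "nat \<Rightarrow> real set \<Rightarrow> bool" where
  "dyadic_determined n B \<longleftrightarrow> B \<subseteq> {0..<1} \<and>
     (\<forall>x\<in>{0..<1}. \<forall>y\<in>{0..<1}. \<lfloor>2 ^ n * x\<rfloor> = \<lfloor>2 ^ n * y\<rfloor> \<longrightarrow> (x \<in> B \<longleftrightarrow> y \<in> B))"

definition dyadic_cell :: "nat \<Rightarrow> nat \<Rightarrow> real set" where
  "dyadic_cell n i = {real i / 2 ^ n ..< real (Suc i) / 2 ^ n}"

abbreviation unit_interval :: "real measure" where
  "unit_interval \<equiv> restrict_space lborel {0..<1}"

lemma prob_space_unit_interval: "prob_space unit_interval"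
  by (intro prob_spaceI) (simp add: emeasure_restrict_space space_restrict_space)

lemma floor_dyadic_coarsen:
  assumes "n \<le> N"
  shows "\<lfloor>2 ^ n * x :: real\<rfloor> = \<lfloor>2 ^ N * x\<rfloor> div 2 ^ (N - n)"
proof -
  have "(2::real) ^ N = 2 ^ n * 2 ^ (N - n)"
    using assms by (simp flip: power_add)
  then have "2 ^ n * x = 2 ^ N * x / real_of_int (2 ^ (N - n))"
    by simp
  then show ?thesis
    by (simp only: floor_divide_real_eq_div zero_le_power zero_le_numeral)
qed

lemma dyadic_determined_subset: "dyadic_determined n B \<Longrightarrow> B \<subseteq> {0..<1}"
  by (simp add: dyadic_determined_def)

lemma dyadic_determined_mono: "dyadic_determined n B \<Longrightarrow> n \<le> N \<Longrightarrow> dyadic_determined N B"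
  unfolding dyadic_determined_def using floor_dyadic_coarsen[of n N] by metis

lemma mem_dyadic_cell:
  "x \<in> dyadic_cell n i \<longleftrightarrow> \<lfloor>2 ^ n * x\<rfloor> = int i"
  unfolding dyadic_cell_def floor_eq_iff by (auto simp: field_simps)

lemma dyadic_cell_subset: "i < 2 ^ n \<Longrightarrow> dyadic_cell n i \<subseteq> {0..<1}"
proof -
  assume "i < 2 ^ n"
  then have "real (Suc i) \<le> real (2 ^ n)" by (intro of_nat_mono) simp
  then have "real (Suc i) / 2 ^ n \<le> 1" by simp
  then show ?thesis
    unfolding dyadic_cell_def by (auto intro: order_trans[rotated])
qed

lemma unit_interval_dyadic_cell:
  assumes "x \<in> {0..<1}"
  shows "\<exists>i<2 ^ n. x \<in> dyadic_cell n i"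
proof (intro exI conjI)
  have nn: "0 \<le> 2 ^ n * x" "2 ^ n * x < 2 ^ n" using assms by auto
  then show "x \<in> dyadic_cell n (nat \<lfloor>2 ^ n * x\<rfloor>)"
    by (simp add: mem_dyadic_cell)
  have "\<lfloor>2 ^ n * x\<rfloor> < 2 ^ n"
    using nn by (simp add: floor_less_iff)
  then show "nat \<lfloor>2 ^ n * x\<rfloor> < 2 ^ n"
    by (simp add: nat_less_iff)
qed

lemma dyadic_determined_cell: "i < 2 ^ n \<Longrightarrow> dyadic_determined n (dyadic_cell n i)"
  using dyadic_cell_subset by (simp add: dyadic_determined_def mem_dyadic_cell)

lemma measure_dyadic_cell: "measure lborel (dyadic_cell n i) = 1 / 2 ^ n"
  by (simp add: dyadic_cell_def diff_divide_distrib[symmetric] divide_right_mono)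

lemma dyadic_point_in_cell: "real i / 2 ^ n \<in> dyadic_cell n i"
  by (simp add: dyadic_cell_def divide_strict_right_mono)

lemma dyadic_determined_UN:
  assumes B: "dyadic_determined n B"
  shows "B = (\<Union>i\<in>{i. i < 2 ^ n \<and> real i / 2 ^ n \<in> B}. dyadic_cell n i)"
proof -
  have iff: "x \<in> B \<longleftrightarrow> real i / 2 ^ n \<in> B" if "i < 2 ^ n" "x \<in> dyadic_cell n i" for i x
  proof -
    have "x \<in> {0..<1}" "real i / 2 ^ n \<in> {0..<1}"
      using dyadic_cell_subset[OF that(1)] that(2) dyadic_point_in_cell by blast+
    moreover have "\<lfloor>2 ^ n * x\<rfloor> = \<lfloor>2 ^ n * (real i / 2 ^ n)\<rfloor>"
      using that(2) dyadic_point_in_cell[of i n] by (simp only: mem_dyadic_cell)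
    ultimately show ?thesis
      using B unfolding dyadic_determined_def by blast
  qed
  show ?thesis
  proof (rule set_eqI)
    fix x
    show "x \<in> B \<longleftrightarrow> x \<in> (\<Union>i\<in>{i. i < 2 ^ n \<and> real i / 2 ^ n \<in> B}. dyadic_cell n i)"
    proof
      assume x: "x \<in> B"
      then have "x \<in> {0..<1}" using dyadic_determined_subset[OF B] by (rule subsetD[rotated])
      then obtain i where "i < 2 ^ n" "x \<in> dyadic_cell n i"
        using unit_interval_dyadic_cell by blast
      then show "x \<in> (\<Union>i\<in>{i. i < 2 ^ n \<and> real i / 2 ^ n \<in> B}. dyadic_cell n i)"
        using iff x by blast
    qed (use iff in blast)
  qed
qed

lemma dyadic_determined_sets: "dyadic_determined n B \<Longrightarrow> B \<in> sets unit_interval"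
proof -
  assume B: "dyadic_determined n B"
  have "(\<Union>i\<in>{i. i < 2 ^ n \<and> real i / 2 ^ n \<in> B}. dyadic_cell n i) \<in> sets borel"
    by (intro sets.finite_UN) (auto simp: dyadic_cell_def)
  then have "B \<in> sets borel"
    using dyadic_determined_UN[OF B] by simp
  moreover have "B \<subseteq> {0..<1}"
    using B by (simp add: dyadic_determined_def)
  ultimately show ?thesis
    by (simp add: sets_restrict_space_iff)
qed

lemma measure_dyadic_determined:
  assumes B: "dyadic_determined n B"
  shows "measure unit_interval B = card {i. i < 2 ^ n \<and> real i / 2 ^ n \<in> B} / 2 ^ n"
proof -
  have "measure unit_interval B = measure lborel B"
    using dyadic_determined_subset[OF B] by (intro measure_restrict_space) simp_all
  also have "\<dots> = measure lborel (\<Union>i\<in>{i. i < 2 ^ n \<and> real i / 2 ^ n \<in> B}. dyadic_cell n i)"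
    using dyadic_determined_UN[OF B] by simp
  also have "\<dots> = (\<Sum>i\<in>{i. i < 2 ^ n \<and> real i / 2 ^ n \<in> B}. measure lborel (dyadic_cell n i))"
  proof (rule measure_finite_Union)
    show "disjoint_family_on (dyadic_cell n) {i. i < 2 ^ n \<and> real i / 2 ^ n \<in> B}"
      by (auto simp: disjoint_family_on_def mem_dyadic_cell)
    have "emeasure lborel (dyadic_cell n i) = ennreal (real (Suc i) / 2 ^ n - real i / 2 ^ n)" for i
      unfolding dyadic_cell_def by (intro emeasure_lborel_Ico divide_right_mono) simp_all
    then show "emeasure lborel (dyadic_cell n i) \<noteq> \<infinity>" for i
      by simp
  qed (auto simp: dyadic_cell_def)
  also have "\<dots> = card {i. i < 2 ^ n \<and> real i / 2 ^ n \<in> B} / 2 ^ n"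
    by (simp add: measure_dyadic_cell)
  finally show ?thesis .
qed

text \<open>On sets determined by cells of length \<open>1 / 2 ^ k\<close>, the uniform distribution on the \<open>2 ^ n\<close> left end
  points agrees with Lebesgue measure as soon as \<open>k \<le> n\<close>.\<close>
interpretation dyadic: leaf_space unit_interval "{B. \<exists>n. dyadic_determined n B}"
proof (intro leaf_space.intro leaf_space_axioms.intro prob_space_unit_interval)
  have space: "space unit_interval = {0..<1}"
    by (simp add: space_restrict_space)
  show "algebra (space unit_interval) {B. \<exists>n. dyadic_determined n B}"
    unfolding algebra_iff_Un space
  proof (intro conjI ballI allI)
    show "{B. \<exists>n. dyadic_determined n B} \<subseteq> Pow {0..<1}"
      using dyadic_determined_subset by blast
    show "{} \<in> {B. \<exists>n. dyadic_determined n B}"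
      by (simp add: dyadic_determined_def)
    fix A assume "A \<in> {B. \<exists>n. dyadic_determined n B}"
    then obtain n where A: "dyadic_determined n A" by blast
    then have "dyadic_determined n ({0..<1} - A)"
      unfolding dyadic_determined_def by blast
    then show "{0..<1} - A \<in> {B. \<exists>n. dyadic_determined n B}" by blast
    fix B assume "B \<in> {B. \<exists>n. dyadic_determined n B}"
    then obtain k where B: "dyadic_determined k B" by blast
    have "dyadic_determined (max n k) A" "dyadic_determined (max n k) B"
      using A B by (auto elim: dyadic_determined_mono)
    then have "dyadic_determined (max n k) (A \<union> B)"
      unfolding dyadic_determined_def by blast
    then show "A \<union> B \<in> {B. \<exists>n. dyadic_determined n B}" by blast
  qed
  show "{B. \<exists>n. dyadic_determined n B} \<subseteq> sets unit_interval"
    using dyadic_determined_sets by blast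
  show "\<exists>P. finite P \<and> P \<subseteq> {B. \<exists>n. dyadic_determined n B} \<and> \<Union>P = space unit_interval \<and>
      (\<forall>B\<in>P. measure unit_interval B \<le> e)" if e: "0 < e" for e
  proof -
    obtain n where n: "(1 / 2 :: real) ^ n < e"
      using real_arch_pow_inv[OF e, of "1 / 2"] by auto
    have "measure unit_interval (dyadic_cell n i) \<le> e" if "i < 2 ^ n" for i
    proof -
      have "measure unit_interval (dyadic_cell n i) = measure lborel (dyadic_cell n i)"
        using dyadic_cell_subset[OF that] by (intro measure_restrict_space) auto
      then show ?thesis
        using n by (simp add: measure_dyadic_cell power_one_over)
    qed
    moreover have "\<Union> (dyadic_cell n ` {..<2 ^ n}) = {0..<1}"
      using dyadic_cell_subset unit_interval_dyadic_cell by fast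
    ultimately show ?thesis
      unfolding space
      by (intro exI[of _ "dyadic_cell n ` {..<2 ^ n}"]) (auto intro: dyadic_determined_cell)
  qed
  define q where "q n = map_pmf (\<lambda>i. real i / 2 ^ n) (pmf_of_set {..<2 ^ n :: nat})" for n :: nat
  have ne: "{..<2 ^ n :: nat} \<noteq> {}" for n :: nat
    by (auto simp: lessThan_empty_iff)
  have set_q: "set_pmf (q n) = (\<lambda>i. real i / 2 ^ n) ` {..<2 ^ n}" for n
    unfolding q_def using ne by simp
  have sub_q: "set_pmf (q n) \<subseteq> {0..<1}" for n
    unfolding set_q using dyadic_cell_subset dyadic_point_in_cell by blast
  have prob_q: "measure_pmf.prob (q n) B = card {i. i < 2 ^ n \<and> real i / 2 ^ n \<in> B} / 2 ^ n" for n B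
  proof -
    have "measure_pmf.prob (q n) B = card ({..<2 ^ n} \<inter> (\<lambda>i. real i / 2 ^ n) -` B) / card {..<2 ^ n :: nat}"
      unfolding q_def measure_map_pmf by (intro measure_pmf_of_set ne) simp
    also have "{..<2 ^ n} \<inter> (\<lambda>i. real i / 2 ^ n) -` B = {i. i < 2 ^ n \<and> real i / 2 ^ n \<in> B}"
      by auto
    finally show ?thesis by simp
  qed
  have "(\<lambda>n. measure_pmf.prob (q n) B) \<longlonglongrightarrow> measure unit_interval B" if B: "dyadic_determined k B" for k B
  proof (rule tendsto_eventually)
    show "\<forall>\<^sub>F n in sequentially. measure_pmf.prob (q n) B = measure unit_interval B"
      unfolding eventually_sequentially
    proof (intro exI allI impI)
      fix n assume "k \<le> n"
      then show "measure_pmf.prob (q n) B = measure unit_interval B"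
        using measure_dyadic_determined[OF dyadic_determined_mono[OF B]] prob_q by simp
    qed
  qed
  then show "\<exists>q. (\<forall>n. finite (set_pmf (q n)) \<and> set_pmf (q n) \<subseteq> space unit_interval) \<and>
      (\<forall>B\<in>{B. \<exists>n. dyadic_determined n B}. (\<lambda>n. measure_pmf.prob (q n) B) \<longlonglongrightarrow> measure unit_interval B)"
    unfolding space using sub_q set_q by (intro exI[of _ q]) auto
qed

section \<open>Coding the points\<close>

text \<open>Both nodes (via the representation of countable ordinals as sets of naturals) and reals inject
  into \<open>nat set\<close>, so members of the algebra are coded by sets of sets of naturals.\<close>
definition join_sets :: "nat set \<Rightarrow> nat set \<Rightarrow> nat set" where
  "join_sets A B = (\<lambda>n. 2 * n) ` A \<union> (\<lambda>n. 2 * n + 1) ` B"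

lemma join_sets_eq_iff [simp]: "join_sets A B = join_sets A' B' \<longleftrightarrow> A = A' \<and> B = B'"
proof
  assume eq: "join_sets A B = join_sets A' B'"
  have "A = {n. 2 * n \<in> join_sets A B}" "B = {n. 2 * n + 1 \<in> join_sets A B}" for A B
    unfolding join_sets_def by (auto; presburger)+
  then show "A = A' \<and> B = B'"
    using eq by metis
qed simp

definition cut :: "real \<Rightarrow> nat set" where
  "cut x = {n. of_rat (from_nat n) < x}"

lemma cut_eq_iff [simp]: "cut x = cut y \<longleftrightarrow> x = y"
proof
  have "\<not> x < y" if "cut x = cut y" for x y
  proof
    assume "x < y"
    then obtain r where r: "x < of_rat r" "of_rat r < y"
      using of_rat_dense by blast
    then have "to_nat r \<in> cut y" "to_nat r \<notin> cut x"
      by (simp_all add: cut_def)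
    then show False using that by simp
  qed
  then show "cut x = cut y \<Longrightarrow> x = y"
    by (metis linorder_neqE)
qed simp

definition point_code :: "node \<times> real \<Rightarrow> nat set" where
  "point_code z = join_sets (join_sets (Rep_omega1 (fst (fst z))) {to_nat (snd (fst z))}) (cut (snd z))"

lemma inj_point_code: "inj point_code"
  by (rule injI) (auto simp: point_code_def Rep_omega1_inject prod_eq_iff)

interpretation forest: measure_forest unit_interval "{B. \<exists>n. dyadic_determined n B}" "(`) point_code"
  by unfold_locales (simp add: inj_on_def inj_image_eq_iff[OF inj_point_code])

section \<open>Strictness of the hierarchy\<close>

theorem corollary2p2:
  shows "\<exists>K :: (nat set set \<Rightarrow> bool) topology. stone_space K \<and>
    (\<forall>\<alpha> :: omega1. \<alpha> \<noteq> bot \<longrightarrow>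
       S K (topspace K) \<alpha> - (\<Union>\<beta>\<in>{..<\<alpha>}. S K (topspace K) \<beta>) \<noteq> {})"
  using forest.stone_space_K forest.hierarchy_strict by blast

end
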